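(* The sesqui-linear form $\hat{\mathfrak{t}}$ on $\mathfrak{N}\times\mathfrak{N}$ is an ultra-weak time operator of $h=\frac12(p^2+q^2)$ with symmetric domain $\mathfrak{N}$ and ultra-weak CCR-domain $\mathfrak{N}$.
   Context: Work in $L^2(\mathbb{R})$ with $(f,g)=\int\overline{f}g\,dx$; $q$ is multiplication by $x$, $p=-i\,d/dx$, and $h=\frac12(p^2+q^2)$ is self-adjoint on $D(p^2)\cap D(q^2)$. Let $\mathbb{H}=\{z\in\mathbb C:\operatorname{Im}z>0\}$, $\xi_z(x)=e^{izx^2/2}$ for $z\in\mathbb H$, $\mathscr{C}(z)=\frac{z-i}{z+i}$, and $\log w=\log|w|+i\arg w$ with $-\pi\le\arg w<\pi$. For $z\in\mathbb H\setminus\{i\}$ set $L_0(z)=\log(-\mathscr C(z))$ and, for $k\ge1$, $L_k(z)=\frac{d^{k-1}}{dz^{k-1}}\frac{2i}{1+z^2}$ (the $k$-th $z$-derivative of $\log(-\mathscr C(z))$ where that function is holomorphic). For $n\ge0$ define $[t_z^nL](x,z)=\sum_{k=0}^n\binom nk x^{2(n-k)}(-2i)^kL_k(z)$ (this is $t_z^n$, $t_z=x^2-2i\,\frac{d}{dz}$, applied to $\log(-\mathscr C(z))$), and for a polynomial $\rho(s)=\sum_n c_ns^n$ put $[\rho(t_z)L]=\sum_nc_n[t_z^nL]$. Let $\mathfrak N_0$ be the span of $\{\rho(x^2)\xi_z:\rho$ polynomial, $z\in\mathbb H\setminus\{i\}\}$, $\mathfrak N_1$ the span of $\{\rho(x^2)x\xi_z\}$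 (same ranges), $\mathfrak N=\mathfrak N_0\oplus\mathfrak N_1$. Define linear operators $\hat S$ on $\mathfrak N_0$ and $\hat S^*$ on $\mathfrak N_1$ (notation only) by $\hat S(\rho(x^2)\xi_z)=\frac i2[\rho(t_z)L](x,z)\,\xi_z$ and $\hat S^*(\rho(x^2)x\xi_z)=\frac i2[\rho(t_z)L](x,z)\,x\xi_z$, extended linearly. Define $\hat{\mathfrak t}_0[\psi,\phi]=\frac12((\hat S\psi,\phi)+(\psi,\hat S\phi))$ on $\mathfrak N_0$, $\hat{\mathfrak t}_1[\psi,\phi]=\frac12((\hat S^*\psi,\phi)+(\psi,\hat S^*\phi))$ on $\mathfrak N_1$, and $\hat{\mathfrak t}[\psi_0\oplus\psi_1,\phi_0\oplus\phi_1]=\hat{\mathfrak t}_0[\psi_0,\phi_0]+\hat{\mathfrak t}_1[\psi_1,\phi_1]$. Definition (ultra-weak time operator): for $H$ self-adjoint on $\mathcal H$ and nonzero subspaces $D_1,D_2$, a sesqui-linear form $\mathfrak t:D_1\times D_2\to\mathbb C$ is an ultra-weak time operator of $H$ with symmetric domain $D$ and ultra-weak CCR-domain $E$ ($D,E$ nonzero subspaces of $D_1\cap D_2$) if (1) $E\subset D(H)\cap D$; (2) $\overline{\mathfrak t[\phi,\psi]}=\mathfrak t[\psi,\phi]$ for $\phi,\psi\in D$; (3) $HE\subset D_1$ and $\mathfrak t[H\phi,\psi]-\overline{\mathfrak t[H\psi,\phi]}=-i(\phi,\psi)$ for $\phi,\psi\in E$. *)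

theory Defs
  imports "HOL-Analysis.Analysis"
begin

text \<open>Elements of L2(R) are represented by functions real => complex
  (representatives of the equivalence classes).\<close>

definition L2fun :: "(real \<Rightarrow> complex) \<Rightarrow> bool" where
  "L2fun f \<longleftrightarrow> f \<in> borel_measurable lborel \<and> integrable lborel (\<lambda>x. (cmod (f x))^2)"

definition ipL2 :: "(real \<Rightarrow> complex) \<Rightarrow> (real \<Rightarrow> complex) \<Rightarrow> complex" where
  "ipL2 f g = integral\<^sup>L lborel (\<lambda>x. cnj (f x) * g x)"

definition L2_subspace :: "(real \<Rightarrow> complex) set \<Rightarrow> bool" where
  "L2_subspace S \<longleftrightarrow> S \<subseteq> {f. L2fun f} \<and> (\<lambda>x. 0) \<in> S
     \<and> (\<forall>f\<in>S. \<forall>g\<in>S. (\<lambda>x. f x + g x) \<in> S)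
     \<and> (\<forall>c. \<forall>f\<in>S. (\<lambda>x. c * f x) \<in> S)"

definition nonzero_L2_subspace :: "(real \<Rightarrow> complex) set \<Rightarrow> bool" where
  "nonzero_L2_subspace S \<longleftrightarrow> L2_subspace S \<and> (\<exists>f\<in>S. \<not> (AE x in lborel. f x = 0))"

definition sesquilinear_on ::
  "(real \<Rightarrow> complex) set \<Rightarrow> (real \<Rightarrow> complex) set \<Rightarrow>
   ((real \<Rightarrow> complex) \<Rightarrow> (real \<Rightarrow> complex) \<Rightarrow> complex) \<Rightarrow> bool" where
  "sesquilinear_on D1 D2 t \<longleftrightarrow>
     (\<forall>f\<in>D1. \<forall>f'\<in>D1. \<forall>g\<in>D2. \<forall>c.
        t (\<lambda>x. f x + f' x) g = t f g + t f' g \<and> t (\<lambda>x. c * f x) g = cnj c * t f g) \<and>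
     (\<forall>f\<in>D1. \<forall>g\<in>D2. \<forall>g'\<in>D2. \<forall>c.
        t f (\<lambda>x. g x + g' x) = t f g + t f g' \<and> t f (\<lambda>x. c * g x) = c * t f g)"

definition ultra_weak_time_operator ::
  "(real \<Rightarrow> complex) set \<Rightarrow> ((real \<Rightarrow> complex) \<Rightarrow> (real \<Rightarrow> complex)) \<Rightarrow>
   ((real \<Rightarrow> complex) \<Rightarrow> (real \<Rightarrow> complex) \<Rightarrow> complex) \<Rightarrow>
   (real \<Rightarrow> complex) set \<Rightarrow> (real \<Rightarrow> complex) set \<Rightarrow>
   (real \<Rightarrow> complex) set \<Rightarrow> (real \<Rightarrow> complex) set \<Rightarrow> bool" where
  "ultra_weak_time_operator DH Hop t D1 D2 D E \<longleftrightarrow>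
     nonzero_L2_subspace D1 \<and> nonzero_L2_subspace D2 \<and> sesquilinear_on D1 D2 t \<and>
     nonzero_L2_subspace D \<and> nonzero_L2_subspace E \<and> D \<subseteq> D1 \<inter> D2 \<and> E \<subseteq> D1 \<inter> D2 \<and>
     E \<subseteq> DH \<inter> D \<and>
     (\<forall>\<phi>\<in>D. \<forall>\<psi>\<in>D. cnj (t \<phi> \<psi>) = t \<psi> \<phi>) \<and>
     Hop ` E \<subseteq> D1 \<and>
     (\<forall>\<phi>\<in>E. \<forall>\<psi>\<in>E. t (Hop \<phi>) \<psi> - cnj (t (Hop \<psi>) \<phi>) = - \<i> * ipL2 \<phi> \<psi>)"

text \<open>The harmonic oscillator h = (p^2+q^2)/2 on D(p^2) \<inter> D(q^2).
  D(p^2) = H^2(R): (representatives) f in L2, C^1 with derivative g in L2, g absolutely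
  continuous with second derivative k in L2.\<close>
definition dom_h :: "(real \<Rightarrow> complex) set" where
  "dom_h = {f. L2fun f \<and> L2fun (\<lambda>x. complex_of_real (x^2) * f x) \<and>
     (\<exists>g k. (\<forall>x. (f has_vector_derivative g x) (at x)) \<and> L2fun g \<and> L2fun k \<and>
            (\<forall>a b. a \<le> b \<longrightarrow> (k has_integral (g b - g a)) {a..b}))}"

definition h_op :: "(real \<Rightarrow> complex) \<Rightarrow> (real \<Rightarrow> complex)" where
  "h_op f = (\<lambda>x. (- vector_derivative (\<lambda>y. vector_derivative f (at y)) (at x)
                   + complex_of_real (x^2) * f x) / 2)"

definition Hp_minus_i :: "complex set" where
  "Hp_minus_i = {z. Im z > 0} - {\<i>}"

definition xi :: "complex \<Rightarrow> real \<Rightarrow> complex" where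
  "xi z x = exp (\<i> * z * complex_of_real (x^2) / 2)"

definition cayley :: "complex \<Rightarrow> complex" where
  "cayley z = (z - \<i>) / (z + \<i>)"

definition arg_br :: "complex \<Rightarrow> real" where
  "arg_br w = (THE a. - pi \<le> a \<and> a < pi \<and> w = complex_of_real (cmod w) * cis a)"

definition log_br :: "complex \<Rightarrow> complex" where
  "log_br w = complex_of_real (ln (cmod w)) + \<i> * complex_of_real (arg_br w)"

definition Lk :: "nat \<Rightarrow> complex \<Rightarrow> complex" where
  "Lk k z = (if k = 0 then log_br (- cayley z)
             else (deriv ^^ (k - 1)) (\<lambda>w. 2 * \<i> / (1 + w^2)) z)"

definition tL :: "nat \<Rightarrow> real \<Rightarrow> complex \<Rightarrow> complex" where
  "tL n x z = (\<Sum>k\<le>n. of_nat (n choose k) * complex_of_real (x^(2*(n-k))) * (-2*\<i>)^k * Lk k z)"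

text \<open>A finite list of triples (c,n,z) represents the function sum c x^(2n) xi_z(x);
  every element of the span N_0 has such a representation (expand rho into monomials).\<close>
definition gen0 :: "(complex \<times> nat \<times> complex) list \<Rightarrow> real \<Rightarrow> complex" where
  "gen0 rs = (\<lambda>x. sum_list (map (\<lambda>(c, n, z). c * complex_of_real (x^(2*n)) * xi z x) rs))"

definition gen1 :: "(complex \<times> nat \<times> complex) list \<Rightarrow> real \<Rightarrow> complex" where
  "gen1 rs = (\<lambda>x. complex_of_real x * gen0 rs x)"

definition valid_rep :: "(complex \<times> nat \<times> complex) list \<Rightarrow> bool" where
  "valid_rep rs \<longleftrightarrow> (\<forall>(c, n, z) \<in> set rs. z \<in> Hp_minus_i)"

definition N0 :: "(real \<Rightarrow> complex) set" where
  "N0 = {gen0 rs | rs. valid_rep rs}"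

definition N1 :: "(real \<Rightarrow> complex) set" where
  "N1 = {gen1 rs | rs. valid_rep rs}"

definition Nfrak :: "(real \<Rightarrow> complex) set" where
  "Nfrak = {(\<lambda>x. a x + b x) | a b. a \<in> N0 \<and> b \<in> N1}"

definition S_rep :: "(complex \<times> nat \<times> complex) list \<Rightarrow> real \<Rightarrow> complex" where
  "S_rep rs = (\<lambda>x. sum_list (map (\<lambda>(c, n, z). c * (\<i> / 2) * tL n x z * xi z x) rs))"

definition S_hat :: "(real \<Rightarrow> complex) \<Rightarrow> (real \<Rightarrow> complex)" where
  "S_hat \<psi> = S_rep (SOME rs. valid_rep rs \<and> gen0 rs = \<psi>)"

definition S_hat_star :: "(real \<Rightarrow> complex) \<Rightarrow> (real \<Rightarrow> complex)" where
  "S_hat_star \<psi> = (\<lambda>x. complex_of_real x * S_rep (SOME rs. valid_rep rs \<and> gen1 rs = \<psi>) x)"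

definition t_hat0 :: "(real \<Rightarrow> complex) \<Rightarrow> (real \<Rightarrow> complex) \<Rightarrow> complex" where
  "t_hat0 \<psi> \<phi> = (ipL2 (S_hat \<psi>) \<phi> + ipL2 \<psi> (S_hat \<phi>)) / 2"

definition t_hat1 :: "(real \<Rightarrow> complex) \<Rightarrow> (real \<Rightarrow> complex) \<Rightarrow> complex" where
  "t_hat1 \<psi> \<phi> = (ipL2 (S_hat_star \<psi>) \<phi> + ipL2 \<psi> (S_hat_star \<phi>)) / 2"

definition dec :: "(real \<Rightarrow> complex) \<Rightarrow> (real \<Rightarrow> complex) \<times> (real \<Rightarrow> complex)" where
  "dec \<psi> = (SOME p. fst p \<in> N0 \<and> snd p \<in> N1 \<and> \<psi> = (\<lambda>x. fst p x + snd p x))"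

definition t_hat :: "(real \<Rightarrow> complex) \<Rightarrow> (real \<Rightarrow> complex) \<Rightarrow> complex" where
  "t_hat \<psi> \<phi> = t_hat0 (fst (dec \<psi>)) (fst (dec \<phi>)) + t_hat1 (snd (dec \<psi>)) (snd (dec \<phi>))"

end

theory Submission
  imports Defs "HOL-Probability.Sinc_Integral"
begin

text \<open>
  Functions \<open>x ^ (2 * n) * xi z x\<close> with distinct \<open>(n, z)\<close> are linearly independent, so the form is
  determined by its values on generators, and \<open>N0\<close>, \<open>N1\<close> are separated by parity. On both parts the
  oscillator \<open>h\<close> preserves the span of the generators, is symmetric there (the Wronskian decays
  rapidly), and satisfies \<open>[h, S] = -\<i>\<close>. The CCR for the form is then
  \<open>(([S, h] \<phi>, \<psi>) + (\<phi>, [h, S] \<psi>)) / 2 = -\<i> (\<phi>, \<psi>)\<close>.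

  The commutator only involves the differentiated equation \<open>(1 + z\<^sup>2) L' = 2 \<i>\<close>, i.e. the three-term
  recurrence of the \<open>Lk\<close>, in which \<open>Lk 0\<close> occurs with coefficient \<open>0\<close>. Hence the branch of the
  logarithm plays no role.
\<close>

section \<open>Linear independence\<close>

text \<open>The outer induction is on the set of exponents, the inner one on the number of
  derivatives that annihilate the polynomial at the new exponent \<open>a\<close>. Positive
  \<open>s\<close> is what the later substitution \<open>s = x^2\<close> with \<open>x > 0\<close>
  supplies.\<close>

lemma exp_poly_independent:
  fixes p :: "complex \<Rightarrow> complex poly"
  assumes "finite Z"
    and "\<And>s::real. s > 0 \<Longrightarrow> (\<Sum>z\<in>Z. poly (p z) (of_real s) * exp (z * of_real s)) = 0"
    and "z \<in> Z"
  shows "p z = 0"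
  using assms
proof (induction Z arbitrary: p z rule: finite_induct)
  case empty
  then show ?case by simp
next
  case (insert a Z)
  \<comment> \<open>Dividing by the exponential of \<open>a\<close> and differentiating lowers the degree of the polynomial at
    \<open>a\<close> and acts injectively on the polynomials at the other exponents.\<close>
  have main: "\<forall>z\<in>insert a Z. p z = 0"
    if "(pderiv ^^ n) (p a) = 0"
      "\<And>s::real. s > 0 \<Longrightarrow>
         (\<Sum>z\<in>insert a Z. poly (p z) (of_real s) * exp (z * of_real s)) = 0"
    for n and p :: "complex \<Rightarrow> complex poly"
    using that
  proof (induction n arbitrary: p)
    case 0
    then have "p a = 0" by simp
    moreover have "p z = 0" if "z \<in> Z" for z
      using insert.IH[OF _ that] 0 insert.hyps by simp
    ultimately show ?case by blast
  next
    case (Suc n)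
    define p' where "p' z = pderiv (p z) + smult (z - a) (p z)" for z
    define F where
      "F s = (\<Sum>z\<in>insert a Z. poly (p z) (of_real s) * exp ((z - a) * of_real s))" for s :: real
    have F0: "F s = 0" if "s > 0" for s
    proof -
      have "F s = exp (- a * of_real s) *
          (\<Sum>z\<in>insert a Z. poly (p z) (of_real s) * exp (z * of_real s))"
        unfolding F_def sum_distrib_left
        by (intro sum.cong refl) (simp add: exp_add[symmetric] algebra_simps)
      then show ?thesis using Suc.prems(2)[OF that] by simp
    qed
    have p'0: "(\<Sum>z\<in>insert a Z. poly (p' z) (of_real s) * exp (z * of_real s)) = 0"
      if s: "s > 0" for s :: real
    proof -
      have "(F has_vector_derivative
          (\<Sum>z\<in>insert a Z. poly (p' z) (of_real s) * exp ((z - a) * of_real s))) (at s)"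
        unfolding F_def
      proof (intro has_vector_derivative_sum)
        fix z
        have "((\<lambda>w. poly (p z) w * exp ((z - a) * w)) has_field_derivative
            poly (p' z) (of_real s) * exp ((z - a) * of_real s)) (at (of_real s))"
          unfolding p'_def by (auto intro!: derivative_eq_intros simp: algebra_simps)
        from has_vector_derivative_real_field[OF this]
        show "((\<lambda>x. poly (p z) (complex_of_real x) * exp ((z - a) * complex_of_real x))
            has_vector_derivative
            poly (p' z) (of_real s) * exp ((z - a) * of_real s)) (at s)" .
      qed
      moreover have "(F has_vector_derivative 0) (at s)"
        by (rule has_vector_derivative_transform_within_open[where f = "\<lambda>_. 0" and S = "{0<..}"])
          (use s F0 in auto)
      ultimately have "(\<Sum>z\<in>insert a Z. poly (p' z) (of_real s) * exp ((z - a) * of_real s)) = 0"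
        by (rule vector_derivative_unique_at)
      moreover have "(\<Sum>z\<in>insert a Z. poly (p' z) (of_real s) * exp (z * of_real s)) =
          exp (a * of_real s) *
          (\<Sum>z\<in>insert a Z. poly (p' z) (of_real s) * exp ((z - a) * of_real s))"
        unfolding sum_distrib_left
        by (intro sum.cong refl) (simp add: exp_add[symmetric] algebra_simps)
      ultimately show ?thesis by simp
    qed
    have "(pderiv ^^ n) (p' a) = 0"
      using Suc.prems(1) by (simp add: p'_def funpow_swap1)
    from Suc.IH[OF this p'0] have p': "\<forall>z\<in>insert a Z. p' z = 0" by blast
    have pZ: "p z = 0" if "z \<in> Z" for z
    proof (rule ccontr)
      assume nz: "p z \<noteq> 0"
      have "z \<noteq> a" using that insert.hyps by auto
      \<comment> \<open>In degree \<open>degree (p z)\<close> the derivative contributes nothing, so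
        the coefficient of \<open>p' z\<close> there is \<open>z - a\<close> times the leading one;
        this is the injectivity away from \<open>a\<close>.\<close>
      have "coeff (p' z) (degree (p z)) = 0" using p' that by simp
      then have "(z - a) * lead_coeff (p z) = 0"
        by (simp add: p'_def coeff_pderiv coeff_eq_0)
      then show False using nz \<open>z \<noteq> a\<close> by simp
    qed
    \<comment> \<open>From \<open>p' a = 0\<close> alone a constant \<open>p a\<close> could
      survive. The original identity, now reduced to its term at \<open>a\<close>, gives infinitely
      many roots.\<close>
    have "poly (p a) (of_real s) = 0" if "s > 0" for s :: real
      using Suc.prems(2)[OF that] pZ insert.hyps by simp
    then have "of_real ` {0<..<1::real} \<subseteq> {w. poly (p a) w = 0}" by auto
    moreover have "infinite (complex_of_real ` {0<..<1::real})"
      by (subst finite_image_iff) (auto simp: inj_on_def)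
    ultimately have "p a = 0" using poly_roots_finite finite_subset by blast
    then show ?case using pZ by blast
  qed
  have "(pderiv ^^ Suc (degree (p a))) (p a) = 0"
  proof -
    have "(pderiv ^^ n) q = 0" if "degree q < n" for n and q :: "complex poly"
      using that
    proof (induction n arbitrary: q)
      case (Suc n)
      show ?case
      proof (cases "degree q = 0")
        case True
        then have "pderiv q = 0" by (simp add: pderiv_eq_0_iff)
        then show ?thesis
          by (simp del: funpow.simps add: funpow_Suc_right)
      next
        case False
        then have "degree (pderiv q) < n" using Suc.prems by (simp add: degree_pderiv)
        then show ?thesis using Suc.IH by (simp del: funpow.simps add: funpow_Suc_right)
      qed
    qed simp
    then show ?thesis by blast
  qed
  from main[OF this insert.prems(1)] insert.prems(2) show ?case by blast
qed

text \<open>Lists of triples serve as formal linear combinations of generators, and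
  \<open>lc \<Phi>\<close> is the linear extension of an arbitrary assignment \<open>\<Phi>\<close>.
  Operator identities are proved for all \<open>\<Phi>\<close> and then specialised to evaluation at
  a point.\<close>

definition lc :: "(nat \<Rightarrow> complex \<Rightarrow> complex) \<Rightarrow> (complex \<times> nat \<times> complex) list \<Rightarrow> complex" where
  "lc \<Phi> rs = (\<Sum>(c, n, z)\<leftarrow>rs. c * \<Phi> n z)"

lemma lc_Nil [simp]: "lc \<Phi> [] = 0"
  and lc_Cons [simp]: "lc \<Phi> ((c, n, z) # rs) = c * \<Phi> n z + lc \<Phi> rs"
  and lc_append [simp]: "lc \<Phi> (rs @ rs') = lc \<Phi> rs + lc \<Phi> rs'"
  by (simp_all add: lc_def)

definition scale :: "complex \<Rightarrow> (complex \<times> nat \<times> complex) list \<Rightarrow> (complex \<times> nat \<times> complex) list"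
  where "scale a rs = map (\<lambda>(c, n, z). (a * c, n, z)) rs"

lemma lc_scale [simp]: "lc \<Phi> (scale a rs) = a * lc \<Phi> rs"
  by (induction rs) (auto simp: scale_def algebra_simps)

lemma lc_linear:
  "lc (\<lambda>n z. a * \<Phi> n z + b * \<Psi> n z) rs = a * lc \<Phi> rs + b * lc \<Psi> rs"
  by (induction rs) (auto simp: algebra_simps)

lemma lc_mult: "lc (\<lambda>n z. a * \<Phi> n z) rs = a * lc \<Phi> rs"
  by (induction rs) (auto simp: algebra_simps)

lemma lc_cong:
  assumes "\<And>c n z. (c, n, z) \<in> set rs \<Longrightarrow> \<Phi> n z = \<Psi> n z"
  shows "lc \<Phi> rs = lc \<Psi> rs"
proof -
  have "map (\<lambda>(c, n, z). c * \<Phi> n z) rs = map (\<lambda>(c, n, z). c * \<Psi> n z) rs"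
    using assms by (intro map_cong) auto
  then show ?thesis unfolding lc_def by (rule arg_cong)
qed

text \<open>Linear independence of the functions \<open>x ^ (2 * n) * xi z x\<close>, phrased so that it yields at once the
  well-definedness of every operator given by its values on the generators.\<close>
lemma lc_eq_0I:
  assumes "\<And>x::real. x > 0 \<Longrightarrow> gen0 rs x = 0"
  shows "lc \<Phi> rs = 0"
proof -
  \<comment> \<open>\<open>P rs z\<close> gathers all triples with the same \<open>z\<close> into
    one polynomial in \<open>s = x^2\<close>; \<open>N\<close> bounds every degree, and the inserted
    0 keeps \<open>Max\<close> meaningful for the empty list.\<close>
  define P where "P rs z = (\<Sum>(c, n, w)\<leftarrow>rs. if w = z then monom c n else 0)"
    for rs :: "(complex \<times> nat \<times> complex) list" and z :: complex
  define Z where "Z = (\<lambda>(c, n, z). z) ` set rs"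
  define N where "N = Max (insert 0 ((\<lambda>(c, n, z). n) ` set rs))"
  have fin: "finite Z" by (simp add: Z_def)
  \<comment> \<open>Regrouping shows that \<open>lc\<close> sees a list only through the polynomials
    \<open>P rs' z\<close>, so their vanishing kills \<open>lc \<Psi>\<close> for every
    \<open>\<Psi>\<close>. \<open>Z\<close> and \<open>N\<close> stay fixed while the induction
    shrinks \<open>rs'\<close>.\<close>
  have expand: "lc \<Psi> rs' = (\<Sum>z\<in>Z. \<Sum>n\<le>N. coeff (P rs' z) n * \<Psi> n z)"
    if "set rs' \<subseteq> set rs" for rs' \<Psi>
    using that
  proof (induction rs')
    case Nil
    then show ?case by (simp add: P_def)
  next
    case (Cons r rs')
    obtain c n w where r: "r = (c, n, w)" by (metis prod_cases3)
    have w: "w \<in> Z" using Cons.prems by (force simp: r Z_def)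
    have n: "n \<le> N" using Cons.prems by (force simp: r N_def intro!: Max_ge)
    have "(\<Sum>z\<in>Z. \<Sum>k\<le>N. coeff (if w = z then monom c n else 0) k * \<Psi> k z)
        = (\<Sum>z\<in>Z. if w = z then c * \<Psi> n z else 0)"
    proof (intro sum.cong refl)
      fix z
      have "(\<Sum>k\<le>N. coeff (monom c n) k * \<Psi> k z) = (\<Sum>k\<le>N. if n = k then c * \<Psi> k z else 0)"
        by (intro sum.cong refl) auto
      also have "\<dots> = c * \<Psi> n z" using n by (simp add: sum.delta')
      finally show "(\<Sum>k\<le>N. coeff (if w = z then monom c n else 0) k * \<Psi> k z)
          = (if w = z then c * \<Psi> n z else 0)" by auto
    qed
    also have "\<dots> = c * \<Psi> n w" using w fin by (simp add: sum.delta')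
    finally show ?case
      using Cons by (simp add: r P_def distrib_right sum.distrib)
  qed
  have deg: "degree (P rs z) \<le> N" for z
  proof -
    have "degree (P rs' z) \<le> N" if "set rs' \<subseteq> set rs" for rs'
      using that
    proof (induction rs')
      case (Cons r rs')
      obtain c n w where r: "r = (c, n, w)" by (metis prod_cases3)
      have n: "n \<le> N"
        using Cons.prems by (force simp: r N_def intro!: Max_ge)
      have "degree (if w = z then monom c n else 0) \<le> N"
        using n degree_monom_le[of c n] by auto
      with Cons show ?case by (simp add: r P_def degree_add_le)
    qed (simp add: P_def)
    then show ?thesis by blast
  qed
  have "P rs z = 0" if "z \<in> Z" for z
  proof -
    \<comment> \<open>With \<open>s = x^2\<close>, \<open>xi z x\<close> is
      \<open>exp (\<i> / 2 * z * s)\<close>; the exponents are therefore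
      \<open>\<i> / 2 * z\<close>, and \<open>q\<close> re-indexes the polynomials
      accordingly.\<close>
    define q where "q w = P rs (w / (\<i> / 2))" for w
    have "q ((\<i> / 2) * z) = 0"
    proof (rule exp_poly_independent)
      show "finite ((*) (\<i> / 2) ` Z)" using fin by simp
      show "(\<i> / 2) * z \<in> (*) (\<i> / 2) ` Z" using that by blast
      fix s :: real
      assume s: "s > 0"
      have "(\<Sum>z\<in>(*) (\<i> / 2) ` Z. poly (q z) (of_real s) * exp (z * of_real s))
          = (\<Sum>z\<in>Z. poly (P rs z) (of_real s) * exp (\<i> / 2 * z * of_real s))"
        by (subst sum.reindex) (auto simp: inj_on_def q_def)
      also have "\<dots> = (\<Sum>z\<in>Z. \<Sum>n\<le>N. coeff (P rs z) n * (of_real s ^ n * exp (\<i> / 2 * z * of_real s)))"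
      proof (intro sum.cong refl)
        fix z
        have "poly (P rs z) (of_real s) = (\<Sum>n\<le>N. coeff (P rs z) n * of_real s ^ n)"
          unfolding poly_altdef using deg
          by (intro sum.mono_neutral_left) (auto simp: coeff_eq_0)
        then show "poly (P rs z) (of_real s) * exp (\<i> / 2 * z * of_real s)
            = (\<Sum>n\<le>N. coeff (P rs z) n * (of_real s ^ n * exp (\<i> / 2 * z * of_real s)))"
          by (simp add: sum_distrib_right mult.assoc)
      qed
      also have "\<dots> = lc (\<lambda>n z. of_real s ^ n * exp (\<i> / 2 * z * of_real s)) rs"
        by (subst expand) simp_all
      also have "\<dots> = gen0 rs (sqrt s)"
      proof -
        have "complex_of_real (sqrt s ^ (2 * n)) = of_real s ^ n" for n
          using s by (simp add: power_mult flip: of_real_power)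
        moreover have "complex_of_real ((sqrt s)\<^sup>2) = of_real s" using s by simp
        ultimately show ?thesis
          unfolding lc_def gen0_def xi_def by (simp only: mult.assoc times_divide_eq_left)
      qed
      also have "\<dots> = 0" using assms s by simp
      finally show "(\<Sum>z\<in>(*) (\<i> / 2) ` Z. poly (q z) (of_real s) * exp (z * of_real s)) = 0" .
    qed
    then show ?thesis by (simp add: q_def)
  qed
  then show ?thesis by (subst expand) simp_all
qed

section \<open>Rapidly decreasing functions\<close>

text \<open>Decay is asked of the function itself; lemmas about derivatives take each derivative as
  a separate rapid function. Continuity provides measurability.\<close>

definition rapid :: "(real \<Rightarrow> complex) \<Rightarrow> bool" where
  "rapid f \<longleftrightarrow> continuous_on UNIV f \<and> (\<forall>m. \<exists>C. \<forall>x. \<bar>x\<bar> ^ m * cmod (f x) \<le> C)"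

lemma rapid_bound:
  assumes "rapid f"
  obtains C where "C > 0" "\<And>x. \<bar>x\<bar> ^ m * cmod (f x) \<le> C"
proof -
  obtain C where C: "\<And>x. \<bar>x\<bar> ^ m * cmod (f x) \<le> C" using assms by (auto simp: rapid_def)
  have "\<bar>x\<bar> ^ m * cmod (f x) \<le> \<bar>C\<bar> + 1" for x using C[of x] by linarith
  then show ?thesis using that[of "\<bar>C\<bar> + 1"] by auto
qed

lemma rapid_cont: "rapid f \<Longrightarrow> continuous_on UNIV f"
  by (simp add: rapid_def)

lemma rapid_0 [simp]: "rapid (\<lambda>x. 0)"
  by (auto simp: rapid_def)

lemma rapid_add:
  assumes f: "rapid f" and g: "rapid g"
  shows "rapid (\<lambda>x. f x + g x)"
  unfolding rapid_def
proof (intro conjI allI)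
  show "continuous_on UNIV (\<lambda>x. f x + g x)"
    using f g by (auto simp: rapid_def intro!: continuous_intros)
  fix m
  obtain C D where C: "\<And>x. \<bar>x\<bar> ^ m * cmod (f x) \<le> C" and D: "\<And>x. \<bar>x\<bar> ^ m * cmod (g x) \<le> D"
    using f g by (metis rapid_bound)
  have "\<bar>x\<bar> ^ m * cmod (f x + g x) \<le> C + D" for x
  proof -
    have "\<bar>x\<bar> ^ m * cmod (f x + g x) \<le> \<bar>x\<bar> ^ m * (cmod (f x) + cmod (g x))"
      by (intro mult_left_mono norm_triangle_ineq) simp
    then show ?thesis using C[of x] D[of x] by (simp add: distrib_left)
  qed
  then show "\<exists>C. \<forall>x. \<bar>x\<bar> ^ m * cmod (f x + g x) \<le> C" by blast
qed

lemma rapid_cnj: "rapid f \<Longrightarrow> rapid (\<lambda>x. cnj (f x))"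
  by (auto simp: rapid_def intro!: continuous_intros)

lemma rapid_mult:
  assumes f: "rapid f" and g: "rapid g"
  shows "rapid (\<lambda>x. f x * g x)"
  unfolding rapid_def
proof (intro conjI allI)
  show "continuous_on UNIV (\<lambda>x. f x * g x)"
    using f g by (auto simp: rapid_def intro!: continuous_intros)
  fix m
  obtain C where C: "C > 0" "\<And>x. \<bar>x\<bar> ^ m * cmod (f x) \<le> C" using f by (metis rapid_bound)
  obtain D where D: "D > 0" "\<And>x. \<bar>x\<bar> ^ 0 * cmod (g x) \<le> D" using g by (metis rapid_bound)
  have "\<bar>x\<bar> ^ m * cmod (f x * g x) \<le> C * D" for x
    using mult_mono[OF C(2)[of x] D(2)[of x]] C(1) by (simp add: norm_mult mult_ac)
  then show "\<exists>C. \<forall>x. \<bar>x\<bar> ^ m * cmod (f x * g x) \<le> C" by blast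
qed

lemma rapid_cmult:
  assumes f: "rapid f"
  shows "rapid (\<lambda>x. c * f x)"
  unfolding rapid_def
proof (intro conjI allI)
  show "continuous_on UNIV (\<lambda>x. c * f x)"
    using f by (auto simp: rapid_def intro!: continuous_intros)
  fix m
  obtain C where C: "C > 0" "\<And>x. \<bar>x\<bar> ^ m * cmod (f x) \<le> C" using f by (metis rapid_bound)
  have "\<bar>x\<bar> ^ m * cmod (c * f x) \<le> cmod c * C" for x
    using mult_left_mono[OF C(2)[of x], of "cmod c"] by (simp add: norm_mult mult_ac)
  then show "\<exists>C. \<forall>x. \<bar>x\<bar> ^ m * cmod (c * f x) \<le> C" by blast
qed

lemma rapid_diff: "rapid f \<Longrightarrow> rapid g \<Longrightarrow> rapid (\<lambda>x. f x - g x)"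
  using rapid_add[of f "\<lambda>x. (- 1) * g x"] rapid_cmult[of g "- 1"] by simp

lemma rapid_power_mult:
  assumes f: "rapid f"
  shows "rapid (\<lambda>x. complex_of_real x ^ k * f x)"
  unfolding rapid_def
proof (intro conjI allI)
  show "continuous_on UNIV (\<lambda>x. complex_of_real x ^ k * f x)"
    using f by (auto simp: rapid_def intro!: continuous_intros)
  fix m
  obtain C where "\<And>x. \<bar>x\<bar> ^ (m + k) * cmod (f x) \<le> C" using f by (metis rapid_bound)
  then show "\<exists>C. \<forall>x. \<bar>x\<bar> ^ m * cmod (complex_of_real x ^ k * f x) \<le> C"
    by (auto simp: norm_mult norm_power power_add mult_ac)
qed

text \<open>This is \<open>t / m \<le> exp (t / m)\<close> raised to the power
  \<open>m\<close>.\<close>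

lemma power_le_exp:
  fixes t :: real
  assumes "t \<ge> 0"
  shows "t ^ m \<le> real m ^ m * exp t"
proof (cases "m = 0")
  case False
  have "(t / real m) ^ m \<le> exp (t / real m) ^ m"
  proof (intro power_mono)
    show "t / real m \<le> exp (t / real m)"
      using exp_ge_add_one_self[of "t / real m"] by linarith
  qed (use assms in simp)
  also have "\<dots> = exp t" using False by (simp add: exp_of_nat_mult[symmetric])
  finally show ?thesis using False by (simp add: power_divide field_simps)
qed (use assms in auto)

lemma rapid_xi:
  assumes "Im z > 0"
  shows "rapid (xi z)"
  unfolding rapid_def
proof (intro conjI allI)
  show "continuous_on UNIV (xi z)"
    unfolding xi_def[abs_def] by (intro continuous_intros) auto
  fix m
  define y where "y = Im z / 2"
  have y: "y > 0" using assms by (simp add: y_def)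
  have norm: "cmod (xi z x) = exp (- (y * x\<^sup>2))" for x
    by (simp add: xi_def y_def power2_eq_square)
  have "\<bar>x\<bar> ^ m * cmod (xi z x) \<le> 1 + (real m / y) ^ m" for x
  proof -
    \<comment> \<open>The Gaussian depends on \<open>x^2\<close> only, so powers of
      \<open>\<bar>x\<bar>\<close> are traded for powers of \<open>x^2\<close>, at the cost of a
      constant near the origin.\<close>
    have "\<bar>x\<bar> \<le> 1 \<or> \<bar>x\<bar> \<le> x\<^sup>2"
      by (metis abs_ge_zero abs_le_square_iff abs_of_nonneg linorder_le_cases mult_left_mono
          mult.right_neutral power2_abs power2_eq_square)
    then have "\<bar>x\<bar> ^ m \<le> 1 \<or> \<bar>x\<bar> ^ m \<le> (x\<^sup>2) ^ m"
      using power_mono[of "\<bar>x\<bar>" "x\<^sup>2" m] power_mono[of "\<bar>x\<bar>" 1 m] by auto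
    then have "\<bar>x\<bar> ^ m \<le> 1 + (x\<^sup>2) ^ m"
      using zero_le_power[OF zero_le_power2[of x], of m] by linarith
    then have "\<bar>x\<bar> ^ m * exp (- (y * x\<^sup>2)) \<le> (1 + (x\<^sup>2) ^ m) * exp (- (y * x\<^sup>2))"
      by (intro mult_right_mono) auto
    also have "\<dots> \<le> 1 + (real m / y) ^ m"
    proof -
      have "(y * x\<^sup>2) ^ m \<le> real m ^ m * exp (y * x\<^sup>2)" using y by (intro power_le_exp) auto
      then have "(x\<^sup>2) ^ m * exp (- (y * x\<^sup>2)) \<le> (real m / y) ^ m"
        using y by (simp add: exp_minus field_simps power_mult_distrib power_divide)
      moreover have "exp (- (y * x\<^sup>2)) \<le> 1" using y by simp
      ultimately show ?thesis unfolding distrib_right by linarith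
    qed
    finally show ?thesis by (simp add: norm)
  qed
  then show "\<exists>C. \<forall>x. \<bar>x\<bar> ^ m * cmod (xi z x) \<le> C" by blast
qed

text \<open>Adding the bounds for the weights \<open>m = 0\<close> and \<open>m = 2\<close> gives an
  integrable majorant that also tends to 0 at both ends of the line.\<close>

lemma rapid_inverse_square_bound:
  assumes "rapid f"
  obtains C where "\<And>x. cmod (f x) \<le> C * inverse (1 + x\<^sup>2)"
proof -
  obtain C where C: "\<And>x. \<bar>x\<bar> ^ 0 * cmod (f x) \<le> C" using assms by (metis rapid_bound)
  obtain D where D: "\<And>x. \<bar>x\<bar> ^ 2 * cmod (f x) \<le> D" using assms by (metis rapid_bound)
  have "cmod (f x) \<le> (C + D) * inverse (1 + x\<^sup>2)" for x
  proof -
    have "0 < 1 + x\<^sup>2" by (simp add: add_pos_nonneg)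
    then show ?thesis using C[of x] D[of x] by (simp add: field_simps)
  qed
  then show ?thesis by (rule that)
qed

lemma rapid_measurable: "rapid f \<Longrightarrow> f \<in> borel_measurable lborel"
  by (simp add: rapid_def borel_measurable_continuous_onI)

lemma rapid_integrable:
  assumes "rapid f"
  shows "integrable lborel f"
proof -
  obtain C where C: "\<And>x. cmod (f x) \<le> C * inverse (1 + x\<^sup>2)"
    using rapid_inverse_square_bound[OF assms] by blast
  have "integrable lborel (\<lambda>x::real. inverse (1 + x\<^sup>2))"
    using integrable_inverse_1_plus_square by (simp add: set_integrable_def)
  then have "integrable lborel (\<lambda>x. C * inverse (1 + x\<^sup>2))" by simp
  then show ?thesis
    by (rule Bochner_Integration.integrable_bound)
      (use C rapid_measurable[OF assms] in \<open>auto intro: order.trans[OF C abs_ge_self]\<close>)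
qed

lemma rapid_L2fun:
  assumes "rapid f"
  shows "L2fun f"
  unfolding L2fun_def
proof
  have "integrable lborel (\<lambda>x. cmod (f x * f x))"
    by (intro integrable_norm rapid_integrable rapid_mult assms)
  then show "integrable lborel (\<lambda>x. (cmod (f x))\<^sup>2)"
    by (simp add: norm_mult power2_eq_square)
qed (rule rapid_measurable[OF assms])

lemma rapid_tendsto_0:
  assumes "rapid f" and F: "filterlim (\<lambda>x. inverse (1 + x\<^sup>2)) (nhds 0) F"
  shows "(f \<longlongrightarrow> 0) F"
proof -
  obtain C where C: "\<And>x. cmod (f x) \<le> C * inverse (1 + x\<^sup>2)"
    using rapid_inverse_square_bound[OF assms(1)] by blast
  show ?thesis
    by (rule Lim_null_comparison[OF always_eventually tendsto_mult_right_zero[OF F]])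
      (use C in auto)
qed

text \<open>The fundamental theorem of calculus on the whole line, with both boundary values 0. All
  integration by parts goes through this lemma.\<close>

lemma rapid_integral_deriv_eq_0:
  assumes f: "rapid f" and f': "rapid f'"
    and der: "\<And>x. (f has_vector_derivative f' x) (at x)"
  shows "integral\<^sup>L lborel f' = 0"
proof -
  have 1: "((\<lambda>x::real. inverse (1 + x\<^sup>2)) \<longlongrightarrow> 0) at_top"
   and 2: "((\<lambda>x::real. inverse (1 + x\<^sup>2)) \<longlongrightarrow> 0) at_bot"
    by real_asymp+
  have "(LBINT x=-\<infinity>..\<infinity>. f' x) = 0 - 0"
  proof (rule interval_integral_FTC_integrable)
    show "isCont f' x" for x
      using rapid_cont[OF f'] by (simp add: continuous_on_eq_continuous_at)
    show "set_integrable lborel (einterval (-\<infinity>) \<infinity>) f'"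
      using rapid_integrable[OF f'] by (simp add: set_integrable_def)
    show "((f \<circ> real_of_ereal) \<longlongrightarrow> 0) (at_right (- \<infinity>))"
      by (simp only: ereal_tendsto_simps1 rapid_tendsto_0[OF f 2])
    show "((f \<circ> real_of_ereal) \<longlongrightarrow> 0) (at_left \<infinity>)"
      by (simp only: ereal_tendsto_simps1 rapid_tendsto_0[OF f 1])
  qed (use der in auto)
  then show ?thesis
    by (simp add: interval_lebesgue_integral_def set_lebesgue_integral_def)
qed

section \<open>The inner product on rapidly decreasing functions\<close>

lemma ipL2_cnj: "cnj (ipL2 f g) = ipL2 g f"
proof -
  have "cnj (ipL2 f g) = (\<integral>x. cnj (cnj (f x) * g x) \<partial>lborel)"
    by (simp only: ipL2_def Bochner_Integration.integral_cnj)
  also have "\<dots> = ipL2 g f" by (simp add: ipL2_def mult.commute)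
  finally show ?thesis .
qed

lemma ipL2_add_right:
  assumes "rapid f" "rapid g" "rapid g'"
  shows "ipL2 f (\<lambda>x. g x + g' x) = ipL2 f g + ipL2 f g'"
  using assms
  by (simp add: ipL2_def distrib_left rapid_integrable rapid_mult rapid_cnj)

lemma ipL2_cmult_right: "ipL2 f (\<lambda>x. c * g x) = c * ipL2 f g"
  by (simp add: ipL2_def mult.left_commute)

lemma ipL2_add_left:
  assumes "rapid f" "rapid f'" "rapid g"
  shows "ipL2 (\<lambda>x. f x + f' x) g = ipL2 f g + ipL2 f' g"
  using assms
  by (simp add: ipL2_def distrib_right rapid_integrable rapid_mult rapid_cnj)

lemma ipL2_cmult_left: "ipL2 (\<lambda>x. c * f x) g = cnj c * ipL2 f g"
  by (simp add: ipL2_def mult.assoc)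

text \<open>The reflection of \<open>x\<close> changes the sign of the integrand. This yields the
  orthogonality of the even part \<open>N0\<close> and the odd part \<open>N1\<close>.\<close>

lemma ipL2_even_odd:
  assumes "\<And>x. f (- x) = f x" "\<And>x. g (- x) = - g x"
  shows "ipL2 f g = 0" "ipL2 g f = 0"
proof -
  have "ipL2 f g = (\<integral>x. cnj (f (0 + - 1 * x)) * g (0 + - 1 * x) \<partial>lborel)"
    unfolding ipL2_def by (subst lborel_integral_real_affine[of "- 1" _ 0]) simp_all
  also have "\<dots> = - ipL2 f g" by (simp add: assms ipL2_def)
  finally show "ipL2 f g = 0" by simp
  then show "ipL2 g f = 0" by (metis ipL2_cnj complex_cnj_zero)
qed

section \<open>The oscillator on rapidly decreasing functions\<close>

lemma vector_derivative_eqI: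
  assumes "\<And>x. (f has_vector_derivative f' x) (at x)"
  shows "(\<lambda>x. vector_derivative f (at x)) = f'"
  using assms by (intro ext vector_derivative_at)

lemma h_op_eq:
  assumes "\<And>x. (f has_vector_derivative f' x) (at x)"
    and "\<And>x. (f' has_vector_derivative f'' x) (at x)"
  shows "h_op f = (\<lambda>x. (- f'' x + complex_of_real (x\<^sup>2) * f x) / 2)"
  by (simp add: h_op_def vector_derivative_eqI[OF assms(1)] vector_derivative_at[OF assms(2)])

text \<open>The classical derivatives \<open>f'\<close> and \<open>f''\<close> are the witnesses;
  since \<open>f''\<close> is continuous, the integral clause is the fundamental theorem of
  calculus.\<close>

lemma dom_hI:
  assumes "rapid f" "rapid f'" "rapid f''"
    and "\<And>x. (f has_vector_derivative f' x) (at x)"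
    and "\<And>x. (f' has_vector_derivative f'' x) (at x)"
  shows "f \<in> dom_h"
proof -
  have "L2fun (\<lambda>x. complex_of_real (x\<^sup>2) * f x)"
    using rapid_L2fun[OF rapid_power_mult[OF assms(1), of 2]] by simp
  moreover have "(f'' has_integral (f' b - f' a)) {a..b}" if "a \<le> b" for a b
    by (rule fundamental_theorem_of_calculus[OF that])
      (use assms in \<open>auto intro: has_vector_derivative_at_within\<close>)
  ultimately show ?thesis
    unfolding dom_h_def using assms(4,5) assms(1-3)[THEN rapid_L2fun] by blast
qed

text \<open>The two integrands differ by half the derivative of the Wronskian \<open>W\<close>,
  because the terms with the real factor \<open>x^2\<close> cancel; the integral of that derivative
  is 0.\<close>

lemma h_op_symmetric:
  assumes f: "rapid f" "rapid f'" "rapid f''"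
      "\<And>x. (f has_vector_derivative f' x) (at x)"
      "\<And>x. (f' has_vector_derivative f'' x) (at x)"
    and g: "rapid g" "rapid g'" "rapid g''"
      "\<And>x. (g has_vector_derivative g' x) (at x)"
      "\<And>x. (g' has_vector_derivative g'' x) (at x)"
  shows "ipL2 (h_op f) g = ipL2 f (h_op g)"
proof -
  define W where "W x = cnj (f x) * g' x - cnj (f' x) * g x" for x
  define W' where "W' x = cnj (f x) * g'' x - cnj (f'' x) * g x" for x
  have r: "rapid (h_op f)" "rapid (h_op g)"
    using rapid_cmult[OF rapid_diff[OF rapid_power_mult[OF f(1), of 2] f(3)], of "1/2"]
      rapid_cmult[OF rapid_diff[OF rapid_power_mult[OF g(1), of 2] g(3)], of "1/2"]
    by (simp_all add: h_op_eq[OF f(4,5)] h_op_eq[OF g(4,5)])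
  have "integral\<^sup>L lborel W' = 0"
  proof (rule rapid_integral_deriv_eq_0)
    show "rapid W" "rapid W'"
      unfolding W_def W'_def using f g by (intro rapid_diff rapid_mult rapid_cnj; simp)+
    show "(W has_vector_derivative W' x) (at x)" for x
      unfolding W_def W'_def
      by (rule derivative_eq_intros has_vector_derivative_mult bounded_linear.has_vector_derivative[OF bounded_linear_cnj] f g refl)+ (simp add: algebra_simps)
  qed
  then have "integral\<^sup>L lborel (\<lambda>x. W' x / 2) = 0" by simp
  moreover have "W' x / 2 = cnj (h_op f x) * g x - cnj (f x) * h_op g x" for x
    by (simp add: W'_def h_op_eq[OF f(4,5)] h_op_eq[OF g(4,5)] field_simps)
  ultimately have "(\<integral>x. cnj (h_op f x) * g x - cnj (f x) * h_op g x \<partial>lborel) = 0" by simp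
  then show ?thesis
    using f(1) g(1) r by (simp add: ipL2_def rapid_integrable rapid_mult rapid_cnj)
qed

section \<open>The commutation relation\<close>

text \<open>Partial fractions: \<open>2 * \<i> / (1 + w^2)\<close> is
  \<open>1 / (w - \<i>) - 1 / (w + \<i>)\<close>, and each summand is differentiated on its
  own.\<close>

lemma Lk_Suc:
  assumes "z \<noteq> \<i>" "z \<noteq> - \<i>"
  shows "Lk (Suc k) z =
    (- 1) ^ k * fact k * (inverse (z - \<i>) ^ Suc k - inverse (z + \<i>) ^ Suc k)"
proof -
  define F where "F k z = (- 1) ^ k * fact k * (inverse (z - \<i>) ^ Suc k - inverse (z + \<i>) ^ Suc k)"
    for k and z :: complex
  have "(deriv ^^ k) (\<lambda>w. 2 * \<i> / (1 + w\<^sup>2)) z = F k z"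
    using assms
  proof (induction k arbitrary: z)
    case 0
    then have nz: "z - \<i> \<noteq> 0" "z + \<i> \<noteq> 0" by (auto simp: add_eq_0_iff2)
    have "1 + z\<^sup>2 = (z - \<i>) * (z + \<i>)" by (simp add: algebra_simps power2_eq_square)
    then show ?case using nz by (simp add: F_def divide_simps)
  next
    case (Suc k)
    then have nz: "z - \<i> \<noteq> 0" "z + \<i> \<noteq> 0" by (auto simp: add_eq_0_iff2)
    \<comment> \<open>\<open>deriv\<close> is local, so the induction hypothesis is needed on a
      neighbourhood; the complement of the two poles is open.\<close>
    have "eventually (\<lambda>w. w \<in> - {\<i>, - \<i>}) (nhds z)"
      using Suc.prems by (intro eventually_nhds_in_open) auto
    then have "eventually (\<lambda>w. (deriv ^^ k) (\<lambda>w. 2 * \<i> / (1 + w\<^sup>2)) w = F k w) (nhds z)"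
      by eventually_elim (use Suc.IH in auto)
    then have "deriv ((deriv ^^ k) (\<lambda>w. 2 * \<i> / (1 + w\<^sup>2))) z = deriv (F k) z"
      by (intro deriv_cong_ev) auto
    also have "(F k has_field_derivative F (Suc k) z) (at z)"
    proof -
      have inv: "((\<lambda>w. inverse (w + a) ^ Suc k) has_field_derivative
          - of_nat (Suc k) * inverse (z + a) ^ Suc (Suc k)) (at z)" if "z + a \<noteq> 0" for a
      proof -
        have "((\<lambda>w. inverse (w + a)) has_field_derivative - (inverse (z + a) * inverse (z + a))) (at z)"
          using that by (auto intro!: derivative_eq_intros)
        from DERIV_power_Suc[OF this, of k] show ?thesis
          by (rule DERIV_cong) (simp add: algebra_simps)
      qed
      have "((\<lambda>w. (- 1) ^ k * fact k * (inverse (w - \<i>) ^ Suc k - inverse (w + \<i>) ^ Suc k))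
        has_field_derivative (- 1) ^ k * fact k * (- of_nat (Suc k) * inverse (z - \<i>) ^ Suc (Suc k)
          - (- of_nat (Suc k) * inverse (z + \<i>) ^ Suc (Suc k)))) (at z)"
        using inv[of "- \<i>"] inv[of \<i>] nz
        by (intro DERIV_cmult DERIV_diff) simp_all
      also have "(- 1) ^ k * fact k * (- of_nat (Suc k) * inverse (z - \<i>) ^ Suc (Suc k)
          - (- of_nat (Suc k) * inverse (z + \<i>) ^ Suc (Suc k))) = F (Suc k) z"
        by (simp add: F_def algebra_simps)
      finally show ?thesis unfolding F_def[abs_def] .
    qed
    then have "deriv (F k) z = F (Suc k) z" by (rule DERIV_imp_deriv)
    finally show ?case by simp
  qed
  then show ?thesis by (simp add: Lk_def F_def)
qed

text \<open>The \<open>j\<close>-th derivative of \<open>(1 + z^2) * L' = 2 * \<i>\<close>. The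
  Leibniz rule leaves three terms because \<open>1 + z^2\<close> is quadratic. The check uses the
  closed form of the derivatives.\<close>

lemma Lk_recurrence:
  assumes z: "z \<noteq> \<i>" "z \<noteq> - \<i>"
  shows "(1 + z\<^sup>2) * Lk (Suc j) z + 2 * z * of_nat j * Lk j z
      + of_nat j * (of_nat j - 1) * Lk (j - 1) z = (if j = 0 then 2 * \<i> else 0)"
proof -
  define u v where "u = z - \<i>" and "v = z + \<i>"
  have nz: "u \<noteq> 0" "v \<noteq> 0" using z by (auto simp: u_def v_def add_eq_0_iff2)
  have sq: "1 + z\<^sup>2 = u * v" by (simp add: u_def v_def algebra_simps power2_eq_square)
  note L = Lk_Suc[OF z, folded u_def v_def]
  \<comment> \<open>The closed form covers positive indices. For \<open>j = 0\<close> and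
    \<open>j = 1\<close> the recurrence mentions \<open>Lk 0\<close>, with coefficient 0, so these
    cases are separate.\<close>
  consider "j = 0" | "j = 1" | m where "j = Suc (Suc m)" by (metis One_nat_def not0_implies_Suc)
  then show ?thesis
  proof cases
    case 1
    have "u * v * (inverse u - inverse v) = v - u" using nz by (simp add: field_simps)
    also have "\<dots> = 2 * \<i>" by (simp add: u_def v_def)
    finally show ?thesis using 1 by (simp add: L sq)
  next
    case 2
    have "u * v * (inverse v ^ 2 - inverse u ^ 2) + 2 * z * (inverse u - inverse v) = 0"
    proof -
      have "2 * z = u + v" by (simp add: u_def v_def)
      then show ?thesis using nz by (simp add: field_simps power2_eq_square)
    qed
    moreover have "Lk (Suc j) z = inverse v ^ 2 - inverse u ^ 2"
      by (simp add: 2 L power2_eq_square)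
    moreover have "Lk j z = inverse u - inverse v" by (simp add: 2 L)
    ultimately show ?thesis by (simp add: 2 sq)
  next
    case 3
    define s :: complex where "s = (- 1) ^ m * fact (Suc (Suc m))"
    have e1: "Lk (Suc j) z = s * (inverse u ^ Suc (Suc (Suc m)) - inverse v ^ Suc (Suc (Suc m)))"
      by (simp only: 3 L s_def) (simp add: algebra_simps)
    have e2: "of_nat j * Lk j z = - s * (inverse u ^ Suc (Suc m) - inverse v ^ Suc (Suc m))"
      by (simp only: 3 L s_def) (simp add: algebra_simps)
    have e3: "of_nat j * (of_nat j - 1) * Lk (j - 1) z = s * (inverse u ^ Suc m - inverse v ^ Suc m)"
      unfolding 3 by (simp add: L s_def algebra_simps)
    have "(1 + z\<^sup>2) * Lk (Suc j) z + 2 * z * of_nat j * Lk j z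
        + of_nat j * (of_nat j - 1) * Lk (j - 1) z =
        s * (u * v * (inverse u ^ Suc (Suc (Suc m)) - inverse v ^ Suc (Suc (Suc m)))
        - (u + v) * (inverse u ^ Suc (Suc m) - inverse v ^ Suc (Suc m))
        + (inverse u ^ Suc m - inverse v ^ Suc m))"
    proof -
      have "2 * z = u + v" by (simp add: u_def v_def)
      moreover have "2 * z * of_nat j * Lk j z = 2 * z * (of_nat j * Lk j z)" by simp
      ultimately show ?thesis by (simp only: e1 e2 e3 sq) (simp add: algebra_simps)
    qed
    also have "\<dots> = 0"
    proof -
      define a b where "a = inverse u ^ Suc m" and "b = inverse v ^ Suc m"
      have "inverse u ^ Suc (Suc m) = a / u" "inverse u ^ Suc (Suc (Suc m)) = a / u / u"
        "inverse v ^ Suc (Suc m) = b / v" "inverse v ^ Suc (Suc (Suc m)) = b / v / v"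
        by (simp_all add: a_def b_def divide_inverse mult_ac)
      \<comment> \<open>The coefficient of \<open>a\<close> is
        \<open>v / u - (u + v) / u + 1 = 0\<close>, and that of \<open>b\<close> vanishes in the
        same way with \<open>u\<close> and \<open>v\<close> exchanged.\<close>
      moreover have "u * v * (a / u / u - b / v / v) - (u + v) * (a / u - b / v) + (a - b) = 0"
        using nz by (simp add: field_simps)
      ultimately show ?thesis by (simp only: a_def[symmetric] b_def[symmetric] mult_zero_right)
    qed
    finally show ?thesis using 3 by simp
  qed
qed

text \<open>Coefficients of the oscillator on the generators: \<open>h\<close> maps \<open>x ^ (2 * n + e) * xi z x\<close> with
  \<open>e \<in> {0, 1}\<close> to \<open>H_lower e n\<close>, \<open>H_diag e n z\<close> and \<open>(1 + z\<^sup>2) / 2\<close> times the generators with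
  \<open>n - 1\<close>, \<open>n\<close> and \<open>n + 1\<close>; \<open>H_lower e 0 = 0\<close> makes the truncated \<open>0 - 1\<close> harmless.\<close>
definition H_lower :: "nat \<Rightarrow> nat \<Rightarrow> complex" where
  "H_lower e n = - of_nat n * (2 * of_nat n - 1 + 2 * of_nat e)"

definition H_diag :: "nat \<Rightarrow> nat \<Rightarrow> complex \<Rightarrow> complex" where
  "H_diag e n z = - \<i> * z * (4 * of_nat n + 1 + 2 * of_nat e) / 2"

definition H_rep :: "nat \<Rightarrow> (complex \<times> nat \<times> complex) list \<Rightarrow> (complex \<times> nat \<times> complex) list"
  where "H_rep e rs = concat (map (\<lambda>(c, n, z).
    [(c * H_lower e n, n - 1, z), (c * H_diag e n z, n, z), (c * ((1 + z\<^sup>2) / 2), Suc n, z)]) rs)"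

text \<open>Expanding \<open>tL\<close> in powers of \<open>x^2\<close> keeps \<open>z\<close> and
  replaces \<open>n\<close> by the values \<open>n - k\<close>. The factor \<open>x\<close> of the
  odd generators passes through, so one list serves both parities.\<close>

definition S_list :: "(complex \<times> nat \<times> complex) list \<Rightarrow> (complex \<times> nat \<times> complex) list"
  where "S_list rs = concat (map (\<lambda>(c, n, z).
    map (\<lambda>k. (c * (\<i> / 2 * (of_nat (n choose k) * (- 2 * \<i>) ^ k * Lk k z)), n - k, z)) [0..<Suc n]) rs)"

text \<open>An operator on lists is moved onto \<open>\<Phi>\<close> as its transpose; a product of
  operators thereby becomes a calculation with coefficients at a single
  \<open>(n, z)\<close>.\<close>

lemma lc_H_rep: "lc \<Phi> (H_rep e rs) =
    lc (\<lambda>n z. H_lower e n * \<Phi> (n - 1) z + H_diag e n z * \<Phi> n z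
      + (1 + z\<^sup>2) / 2 * \<Phi> (Suc n) z) rs"
  by (induction rs) (auto simp: H_rep_def algebra_simps)

lemma lc_S_list: "lc \<Phi> (S_list rs) =
    lc (\<lambda>n z. \<i> / 2 * (\<Sum>k\<le>n. of_nat (n choose k) * (- 2 * \<i>) ^ k * Lk k z * \<Phi> (n - k) z)) rs"
proof (induction rs)
  case (Cons r rs)
  obtain c n z where r: "r = (c, n, z)" by (metis prod_cases3)
  \<comment> \<open>The upper limit \<open>m\<close> is separated from \<open>n\<close> so that the
    induction can vary one and keep the other.\<close>
  have "lc \<Phi> (map (\<lambda>k. (c * f k, n - k, z)) [0..<m]) = c * (\<Sum>k<m. f k * \<Phi> (n - k) z)" for f m
    by (induction m) (simp_all add: algebra_simps)
  from this[of "\<lambda>k. \<i> / 2 * (of_nat (n choose k) * (- 2 * \<i>) ^ k * Lk k z)" "Suc n"]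
  have "lc \<Phi> (map (\<lambda>k. (c * (\<i> / 2 * (of_nat (n choose k) * (- 2 * \<i>) ^ k * Lk k z)), n - k, z)) [0..<Suc n])
      = c * (\<i> / 2 * (\<Sum>k\<le>n. of_nat (n choose k) * (- 2 * \<i>) ^ k * Lk k z * \<Phi> (n - k) z))"
    by (simp only: lessThan_Suc_atMost sum_distrib_left mult.assoc)
  moreover have "S_list (r # rs) =
      map (\<lambda>k. (c * (\<i> / 2 * (of_nat (n choose k) * (- 2 * \<i>) ^ k * Lk k z)), n - k, z)) [0..<Suc n]
      @ S_list rs" by (simp add: S_list_def r)
  ultimately show ?case using Cons by (simp only: lc_append r lc_Cons)
qed (simp add: S_list_def)

text \<open>With \<open>M k\<close> for \<open>(- 2 * \<i>) ^ k * Lk k z\<close>, the difference is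
  compared coefficient by coefficient in \<open>y (n - j)\<close>. The lowering, diagonal and
  raising parts of the oscillator contribute the three summands of \<open>rec\<close>, each times
  \<open>n choose j\<close>.\<close>

lemma commutator_monomial:
  fixes M y :: "nat \<Rightarrow> complex"
  assumes rec: "\<And>j. 2 * of_nat j * (of_nat j - 1) * M (j - 1) + 2 * \<i> * z * of_nat j * M j
      - (1 + z\<^sup>2) / 2 * M (Suc j) = (if j = 0 then \<kappa> else 0)"
  shows "(\<Sum>k\<le>n. of_nat (n choose k) * M k *
        (H_lower e (n - k) * y (n - k - 1) + H_diag e (n - k) z * y (n - k)
          + (1 + z\<^sup>2) / 2 * y (Suc (n - k))))
    - (H_lower e n * (\<Sum>k\<le>n - 1. of_nat ((n - 1) choose k) * M k * y (n - 1 - k))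
      + H_diag e n z * (\<Sum>k\<le>n. of_nat (n choose k) * M k * y (n - k))
      + (1 + z\<^sup>2) / 2 * (\<Sum>k\<le>Suc n. of_nat (Suc n choose k) * M k * y (Suc n - k)))
    = \<kappa> * y n"
proof -
  have lower: "(\<Sum>k\<le>n. of_nat (n choose k) * M k * (H_lower e (n - k) * y (n - k - 1)))
      - H_lower e n * (\<Sum>k\<le>n - 1. of_nat ((n - 1) choose k) * M k * y (n - 1 - k))
      = (\<Sum>j\<le>n. of_nat (n choose j) * y (n - j) * (2 * of_nat j * (of_nat j - 1) * M (j - 1)))"
  proof (cases n)
    case 0
    then show ?thesis by (simp add: H_lower_def)
  next
    case (Suc m)
    \<comment> \<open>The term \<open>k = n\<close>, where \<open>n - k - 1\<close> is truncated,
      disappears because \<open>H_lower e 0 = 0\<close>.\<close>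
    have top: "(\<Sum>k\<le>n. of_nat (n choose k) * M k * (H_lower e (n - k) * y (n - k - 1)))
        = (\<Sum>k\<le>m. of_nat (n choose k) * M k * (H_lower e (n - k) * y (n - k - 1)))"
      by (simp add: Suc H_lower_def)
    have "(\<Sum>k\<le>n. of_nat (n choose k) * M k * (H_lower e (n - k) * y (n - k - 1)))
        - H_lower e n * (\<Sum>k\<le>n - 1. of_nat ((n - 1) choose k) * M k * y (n - 1 - k))
        = (\<Sum>k\<le>m. (of_nat (n choose k) * H_lower e (n - k)
            - H_lower e n * of_nat (m choose k)) * M k * y (m - k))"
      unfolding top by (simp add: Suc sum_distrib_left sum_subtractf[symmetric] algebra_simps)
    also have "\<dots> = (\<Sum>k\<le>m. of_nat (n choose Suc k) * y (n - Suc k) *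
        (2 * of_nat (Suc k) * (of_nat (Suc k) - 1) * M (Suc k - 1)))"
    proof (intro sum.cong refl)
      fix k assume "k \<in> {..m}"
      then have k: "k \<le> m" by simp
      \<comment> \<open>Two absorption identities express \<open>n choose k\<close> and
        \<open>n choose Suc k\<close> through \<open>n * (m choose k)\<close>; the linear factors of
        \<open>H_lower\<close> then differ by \<open>2 * k\<close>.\<close>
      have "(n - k) * (n choose k) = n * (m choose k)"
        using binomial_absorb_comp[of n k] by (simp add: Suc)
      then have "complex_of_nat (n - k) * of_nat (n choose k) = of_nat n * of_nat (m choose k)"
        by (metis of_nat_mult)
      then have 1: "(of_nat n - of_nat k) * complex_of_nat (n choose k) = of_nat n * of_nat (m choose k)"
        using k by (simp add: Suc of_nat_diff)
      have "Suc k * (n choose Suc k) = n * (m choose k)"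
        by (simp only: Suc Suc_times_binomial)
      then have 2: "complex_of_nat (Suc k) * of_nat (n choose Suc k) = of_nat n * of_nat (m choose k)"
        by (metis of_nat_mult)
      have "of_nat (n choose k) * H_lower e (n - k) - H_lower e n * of_nat (m choose k)
          = - ((of_nat n - of_nat k) * of_nat (n choose k)) * (2 * (of_nat n - of_nat k) - 1 + 2 * of_nat e)
            + (of_nat n * of_nat (m choose k)) * (2 * of_nat n - 1 + 2 * of_nat e)"
        using k by (simp add: H_lower_def Suc of_nat_diff algebra_simps)
      also have "\<dots> = 2 * of_nat k * (of_nat n * of_nat (m choose k))"
        unfolding 1 by (simp add: algebra_simps)
      finally have 3: "of_nat (n choose k) * H_lower e (n - k) - H_lower e n * of_nat (m choose k)
          = 2 * of_nat k * (complex_of_nat (Suc k) * of_nat (n choose Suc k))"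
        by (simp only: 2)
      show "(of_nat (n choose k) * H_lower e (n - k) - H_lower e n * of_nat (m choose k)) * M k * y (m - k)
        = of_nat (n choose Suc k) * y (n - Suc k) *
        (2 * of_nat (Suc k) * (of_nat (Suc k) - 1) * M (Suc k - 1))"
        unfolding 3 by (simp add: Suc)
    qed
    \<comment> \<open>Re-indexing with \<open>j = Suc k\<close>; the added term \<open>j = 0\<close>
      is 0 through its factor \<open>j\<close>.\<close>
    also have "\<dots> = (\<Sum>j\<le>n. of_nat (n choose j) * y (n - j) * (2 * of_nat j * (of_nat j - 1) * M (j - 1)))"
      by (simp only: Suc sum.atMost_Suc_shift) simp
    finally show ?thesis .
  qed
  have diag: "(\<Sum>k\<le>n. of_nat (n choose k) * M k * (H_diag e (n - k) z * y (n - k)))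
      - H_diag e n z * (\<Sum>k\<le>n. of_nat (n choose k) * M k * y (n - k))
      = (\<Sum>j\<le>n. of_nat (n choose j) * y (n - j) * (2 * \<i> * z * of_nat j * M j))"
    unfolding sum_distrib_left sum_subtractf[symmetric]
    by (intro sum.cong refl) (simp add: H_diag_def of_nat_diff field_simps)
  \<comment> \<open>Since \<open>n choose Suc n = 0\<close>, both sums can run to
    \<open>Suc n\<close>. Their first terms cancel and Pascal's rule gives the rest.\<close>
  have "(\<Sum>k\<le>n. of_nat (n choose k) * M k * y (Suc (n - k)))
      = (\<Sum>k\<le>Suc n. of_nat (n choose k) * M k * y (Suc n - k))"
    by (simp add: Suc_diff_le)
  then have pascal: "(\<Sum>k\<le>n. of_nat (n choose k) * M k * y (Suc (n - k)))
      - (\<Sum>k\<le>Suc n. of_nat (Suc n choose k) * M k * y (Suc n - k))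
      = - (\<Sum>j\<le>n. of_nat (n choose j) * y (n - j) * M (Suc j))"
    by (simp only: sum.atMost_Suc_shift)
      (simp add: sum_negf[symmetric] sum_subtractf[symmetric] algebra_simps)
  have raise: "(\<Sum>k\<le>n. of_nat (n choose k) * M k * ((1 + z\<^sup>2) / 2 * y (Suc (n - k))))
      - (1 + z\<^sup>2) / 2 * (\<Sum>k\<le>Suc n. of_nat (Suc n choose k) * M k * y (Suc n - k))
      = (\<Sum>j\<le>n. of_nat (n choose j) * y (n - j) * (- ((1 + z\<^sup>2) / 2 * M (Suc j))))"
  proof -
    have "(\<Sum>k\<le>n. of_nat (n choose k) * M k * ((1 + z\<^sup>2) / 2 * y (Suc (n - k))))
        = (1 + z\<^sup>2) / 2 * (\<Sum>k\<le>n. of_nat (n choose k) * M k * y (Suc (n - k)))"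
      unfolding sum_distrib_left by (intro sum.cong refl) simp
    moreover have "(\<Sum>j\<le>n. of_nat (n choose j) * y (n - j) * (- ((1 + z\<^sup>2) / 2 * M (Suc j))))
        = (1 + z\<^sup>2) / 2 * - (\<Sum>j\<le>n. of_nat (n choose j) * y (n - j) * M (Suc j))"
      unfolding sum_distrib_left sum_negf[symmetric] by (intro sum.cong refl) simp
    ultimately show ?thesis by (simp only: pascal[symmetric] right_diff_distrib)
  qed
  have "(\<Sum>j\<le>n. of_nat (n choose j) * y (n - j) * (if j = 0 then \<kappa> else 0)) = \<kappa> * y n"
  proof -
    have "(\<Sum>j\<le>n. of_nat (n choose j) * y (n - j) * (if j = 0 then \<kappa> else 0))
        = (\<Sum>j\<le>n. if j = 0 then \<kappa> * y n else 0)"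
      by (intro sum.cong refl) auto
    then show ?thesis by simp
  qed
  moreover have "(\<Sum>j\<le>n. of_nat (n choose j) * y (n - j) * (if j = 0 then \<kappa> else 0))
      = (\<Sum>j\<le>n. of_nat (n choose j) * y (n - j) * (2 * of_nat j * (of_nat j - 1) * M (j - 1)))
      + (\<Sum>j\<le>n. of_nat (n choose j) * y (n - j) * (2 * \<i> * z * of_nat j * M j))
      + (\<Sum>j\<le>n. of_nat (n choose j) * y (n - j) * (- ((1 + z\<^sup>2) / 2 * M (Suc j))))"
    unfolding sum.distrib[symmetric] rec[symmetric]
    by (intro sum.cong refl) (simp only: distrib_left diff_conv_add_uminus)
  ultimately show ?thesis
    unfolding lower[symmetric] diag[symmetric] raise[symmetric]
    by (simp only: distrib_left sum.distrib) (simp only: algebra_simps)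
qed

lemma Hp_minus_iD:
  assumes "z \<in> Hp_minus_i"
  shows "z \<noteq> \<i>" "z \<noteq> - \<i>" "Im z > 0"
  using assms by (auto simp: Hp_minus_i_def)

text \<open>This is \<open>[h, S] = - \<i>\<close> on lists, tested against every
  \<open>\<Phi>\<close>.\<close>

lemma commutator_lc:
  assumes "valid_rep rs"
  shows "lc \<Phi> (H_rep e (S_list rs)) = lc \<Phi> (S_list (H_rep e rs)) - \<i> * lc \<Phi> rs"
proof -
  let ?A = "\<lambda>n z. \<Sum>k\<le>n. of_nat (n choose k) * (- 2 * \<i>) ^ k * Lk k z *
      (H_lower e (n - k) * \<Phi> (n - k - 1) z + H_diag e (n - k) z * \<Phi> (n - k) z
        + (1 + z\<^sup>2) / 2 * \<Phi> (Suc (n - k)) z)"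
  let ?B = "\<lambda>n z. \<Sum>k\<le>n. of_nat (n choose k) * (- 2 * \<i>) ^ k * Lk k z * \<Phi> (n - k) z"
  have "lc \<Phi> (H_rep e (S_list rs)) = lc (\<lambda>n z. \<i> / 2 * ?A n z) rs"
    unfolding lc_H_rep lc_S_list ..
  \<comment> \<open>The factors \<open>1\<close> and \<open>- \<i>\<close> are spelled out to fit
    the pattern of \<open>lc_linear\<close>.\<close>
  also have "\<dots> = lc (\<lambda>n z. 1 * (H_lower e n * (\<i> / 2 * ?B (n - 1) z) + H_diag e n z * (\<i> / 2 * ?B n z)
      + (1 + z\<^sup>2) / 2 * (\<i> / 2 * ?B (Suc n) z)) + (- \<i>) * \<Phi> n z) rs"
  proof (rule lc_cong)
    fix c n z
    assume "(c, n, z) \<in> set rs"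
    then have "z \<in> Hp_minus_i" using assms by (auto simp: valid_rep_def)
    then have z: "z \<noteq> \<i>" "z \<noteq> - \<i>" by (rule Hp_minus_iD)+
    have "?A n z - (H_lower e n * ?B (n - 1) z + H_diag e n z * ?B n z
        + (1 + z\<^sup>2) / 2 * ?B (Suc n) z) = - 2 * \<Phi> n z"
    proof (rule commutator_monomial[where M = "\<lambda>k. (- 2 * \<i>) ^ k * Lk k z" and y = "\<lambda>n. \<Phi> n z",
          unfolded mult.assoc[symmetric]])
      fix j
      \<comment> \<open>The condition is \<open>\<i> * (- 2 * \<i>) ^ j\<close> times the
        recurrence. At \<open>j = 0\<close> it gives \<open>\<i> * (2 * \<i>) = - 2\<close>, which
        the prefactor \<open>\<i> / 2\<close> of \<open>S\<close> turns into
        \<open>- \<i>\<close>.\<close>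
      have "2 * of_nat j * (of_nat j - 1) * (- 2 * \<i>) ^ (j - 1) * Lk (j - 1) z
          + 2 * \<i> * z * of_nat j * (- 2 * \<i>) ^ j * Lk j z
          - (1 + z\<^sup>2) / 2 * (- 2 * \<i>) ^ Suc j * Lk (Suc j) z
        = \<i> * (- 2 * \<i>) ^ j * ((1 + z\<^sup>2) * Lk (Suc j) z + 2 * z * of_nat j * Lk j z
          + of_nat j * (of_nat j - 1) * Lk (j - 1) z)"
        by (cases j) (simp_all add: field_simps)
      then show "2 * of_nat j * (of_nat j - 1) * (- 2 * \<i>) ^ (j - 1) * Lk (j - 1) z
          + 2 * \<i> * z * of_nat j * (- 2 * \<i>) ^ j * Lk j z
          - (1 + z\<^sup>2) / 2 * (- 2 * \<i>) ^ Suc j * Lk (Suc j) z = (if j = 0 then - 2 else 0)"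
        unfolding Lk_recurrence[OF z] by simp
    qed
    then have "?A n z = H_lower e n * ?B (n - 1) z + H_diag e n z * ?B n z
        + (1 + z\<^sup>2) / 2 * ?B (Suc n) z - 2 * \<Phi> n z" by (simp only: diff_eq_eq) simp
    then show "\<i> / 2 * ?A n z = 1 * (H_lower e n * (\<i> / 2 * ?B (n - 1) z) + H_diag e n z * (\<i> / 2 * ?B n z)
      + (1 + z\<^sup>2) / 2 * (\<i> / 2 * ?B (Suc n) z)) + (- \<i>) * \<Phi> n z"
      by (simp only:) (simp only: algebra_simps, simp)
  qed
  finally show ?thesis unfolding lc_H_rep lc_S_list lc_linear by simp
qed

section \<open>The form on the span of the generators\<close>

lemma valid_rep_simps [simp]:
  "valid_rep []"
  "valid_rep ((c, n, z) # rs) \<longleftrightarrow> z \<in> Hp_minus_i \<and> valid_rep rs"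
  "valid_rep (rs @ rs') \<longleftrightarrow> valid_rep rs \<and> valid_rep rs'"
  by (simp_all add: valid_rep_def ball_Un)

lemma valid_rep_scale: "valid_rep rs \<Longrightarrow> valid_rep (scale a rs)"
  by (auto simp: valid_rep_def scale_def)

lemma valid_rep_H_rep: "valid_rep rs \<Longrightarrow> valid_rep (H_rep e rs)"
  by (fastforce simp: valid_rep_def H_rep_def)

lemma valid_rep_S_list: "valid_rep rs \<Longrightarrow> valid_rep (S_list rs)"
  by (fastforce simp: valid_rep_def S_list_def)

text \<open>The parameter \<open>e\<close> is the parity: 0 for \<open>N0\<close> and 1 for
  \<open>N1\<close>, so that both parts are treated at once.\<close>

definition gen :: "nat \<Rightarrow> (complex \<times> nat \<times> complex) list \<Rightarrow> real \<Rightarrow> complex" where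
  "gen e rs x = lc (\<lambda>n z. complex_of_real x ^ (2 * n + e) * xi z x) rs"

lemma gen_eq: "gen e rs x = complex_of_real x ^ e * lc (\<lambda>n z. complex_of_real x ^ (2 * n) * xi z x) rs"
  unfolding gen_def lc_mult[symmetric] by (simp add: power_add mult_ac)

lemma gen0_eq: "gen0 = gen 0"
  by (intro ext) (simp add: gen0_def gen_def lc_def mult.assoc)

lemma gen1_eq: "gen1 = gen 1"
  by (intro ext) (simp add: gen1_def gen0_eq gen_eq)

lemma gen_append: "gen e (rs @ rs') = (\<lambda>x. gen e rs x + gen e rs' x)"
  and gen_scale: "gen e (scale a rs) = (\<lambda>x. a * gen e rs x)"
  by (simp_all add: gen_def fun_eq_iff)

lemma S_rep_eq: "S_rep rs = gen 0 (S_list rs)"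
proof
  fix x
  have "S_rep rs x = lc (\<lambda>n z. \<i> / 2 * tL n x z * xi z x) rs"
    by (simp add: S_rep_def lc_def mult.assoc)
  also have "\<dots> = gen 0 (S_list rs) x"
    unfolding gen_def lc_S_list by (simp add: tL_def sum_distrib_left sum_distrib_right mult_ac)
  finally show "S_rep rs x = gen 0 (S_list rs) x" .
qed

lemma lc_eqI:
  assumes "\<And>x::real. x > 0 \<Longrightarrow> gen0 rs x = gen0 rs' x"
  shows "lc \<Phi> rs = lc \<Phi> rs'"
proof -
  have "lc \<Phi> (rs @ scale (- 1) rs') = 0"
    using assms by (intro lc_eq_0I) (simp add: gen0_eq gen_append gen_scale)
  then show ?thesis by simp
qed

text \<open>The list selected by \<open>SOME\<close> may differ from \<open>rs\<close>, but it
  represents the same function; by linear independence every \<open>lc \<Phi>\<close> agrees on the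
  two.\<close>

lemma S_hat_gen:
  assumes "valid_rep rs"
  shows "S_hat (gen 0 rs) = gen 0 (S_list rs)"
proof -
  define rs' where "rs' = (SOME rs'. valid_rep rs' \<and> gen0 rs' = gen 0 rs)"
  have "valid_rep rs' \<and> gen0 rs' = gen 0 rs"
    unfolding rs'_def by (rule someI[of _ rs]) (simp add: assms gen0_eq)
  then have "lc \<Phi> rs' = lc \<Phi> rs" for \<Phi> by (intro lc_eqI) (simp add: gen0_eq)
  then show ?thesis
    unfolding S_hat_def rs'_def[symmetric] S_rep_eq by (simp add: fun_eq_iff gen_def lc_S_list)
qed

lemma S_hat_star_gen:
  assumes "valid_rep rs"
  shows "S_hat_star (gen 1 rs) = gen 1 (S_list rs)"
proof -
  define rs' where "rs' = (SOME rs'. valid_rep rs' \<and> gen1 rs' = gen 1 rs)"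
  have "valid_rep rs' \<and> gen1 rs' = gen 1 rs"
    unfolding rs'_def by (rule someI[of _ rs]) (simp add: assms gen1_eq)
  then have "complex_of_real x * gen0 rs' x = complex_of_real x * gen0 rs x" for x
    by (metis gen1_def gen1_eq)
  \<comment> \<open>The factor \<open>x\<close> can be cancelled for \<open>x > 0\<close>, which is
    all that \<open>lc_eqI\<close> asks for.\<close>
  then have "lc \<Phi> rs' = lc \<Phi> rs" for \<Phi>
    by (intro lc_eqI) (metis mult_left_cancel of_real_eq_0_iff less_irrefl)
  then show ?thesis
    unfolding S_hat_star_def rs'_def[symmetric] S_rep_eq
    by (simp add: fun_eq_iff gen_eq lc_S_list)
qed

definition pair_gen ::
  "(complex \<times> nat \<times> complex) list \<Rightarrow> (complex \<times> nat \<times> complex) list \<Rightarrow> real \<Rightarrow> complex" where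
  "pair_gen r s x = gen 0 r x + gen 1 s x"

lemma gen_minus: "gen 0 r (- x) = gen 0 r x" "gen 1 r (- x) = - gen 1 r x"
  by (simp_all add: gen_eq xi_def)

text \<open>A function has only one splitting into an even and an odd part, so the choice in
  \<open>dec\<close> is forced.\<close>

lemma dec_pair_gen:
  assumes "valid_rep r" "valid_rep s"
  shows "dec (pair_gen r s) = (gen 0 r, gen 1 s)"
proof -
  define p where "p = dec (pair_gen r s)"
  have "fst p \<in> N0 \<and> snd p \<in> N1 \<and> pair_gen r s = (\<lambda>x. fst p x + snd p x)"
    unfolding p_def dec_def
    by (rule someI[of _ "(gen 0 r, gen 1 s)"])
      (use assms in \<open>auto simp: N0_def N1_def gen0_eq gen1_eq pair_gen_def fun_eq_iff\<close>)
  then obtain r' s' where p: "fst p = gen 0 r'" "snd p = gen 1 s'"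
    and eq: "\<And>x. gen 0 r x + gen 1 s x = gen 0 r' x + gen 1 s' x"
    by (auto simp: N0_def N1_def gen0_eq gen1_eq pair_gen_def fun_eq_iff)
  have "gen 0 r x = gen 0 r' x \<and> gen 1 s x = gen 1 s' x" for x
  proof -
    have "gen 0 r x - gen 1 s x = gen 0 r' x - gen 1 s' x"
      using eq[of "- x"] by (simp only: gen_minus) simp
    moreover note eq[of x]
    ultimately have "2 * gen 0 r x = 2 * gen 0 r' x" by algebra
    then show ?thesis using eq[of x] by simp
  qed
  then show ?thesis using p by (intro prod_eqI) (auto simp: p_def)
qed

lemma Nfrak_eq: "Nfrak = {pair_gen r s | r s. valid_rep r \<and> valid_rep s}"
  unfolding Nfrak_def N0_def N1_def gen0_eq gen1_eq pair_gen_def[abs_def] by blast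

section \<open>Decay, derivatives and the oscillator on the span\<close>

lemma rapid_lc:
  assumes "\<And>c n z. (c, n, z) \<in> set rs \<Longrightarrow> rapid (\<lambda>x. \<Phi> x n z)"
  shows "rapid (\<lambda>x. lc (\<Phi> x) rs)"
  using assms
proof (induction rs)
  case (Cons r rs)
  obtain c n z where r: "r = (c, n, z)" by (metis prod_cases3)
  have "rapid (\<lambda>x. \<Phi> x n z)" using Cons.prems[of c n z] by (simp add: r)
  moreover have "rapid (\<lambda>x. lc (\<Phi> x) rs)"
    by (rule Cons.IH) (use Cons.prems in auto)
  ultimately show ?case by (simp add: r rapid_add rapid_cmult)
qed simp

lemma lc_has_vector_derivative:
  assumes "\<And>n z. ((\<lambda>x. \<Phi> x n z) has_vector_derivative \<Phi>' n z) (at x)"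
  shows "((\<lambda>x. lc (\<Phi> x) rs) has_vector_derivative lc \<Phi>' rs) (at x)"
proof (induction rs)
  case (Cons r rs)
  obtain c n z where r: "r = (c, n, z)" by (metis prod_cases3)
  show ?case unfolding r lc_Cons
    by (intro has_vector_derivative_add Cons
        bounded_linear.has_vector_derivative[OF bounded_linear_mult_right] assms)
qed simp

lemma valid_rep_Im:
  assumes "valid_rep rs" "(c, n, z) \<in> set rs"
  shows "Im z > 0"
  using assms Hp_minus_iD(3) by (auto simp: valid_rep_def)

lemma rapid_gen: "valid_rep rs \<Longrightarrow> rapid (gen e rs)"
  unfolding gen_def[abs_def]
  by (intro rapid_lc rapid_power_mult rapid_xi valid_rep_Im)

text \<open>The derivative of \<open>x ^ m * xi z x\<close>, written in terms of such products so
  that it can be differentiated by the same rule. At \<open>m = 0\<close> the truncated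
  \<open>m - 1\<close> carries the factor 0.\<close>

definition dmon :: "nat \<Rightarrow> complex \<Rightarrow> real \<Rightarrow> complex" where
  "dmon m z x = of_nat m * (complex_of_real x ^ (m - 1) * xi z x)
     + \<i> * z * (complex_of_real x ^ Suc m * xi z x)"

definition ddmon :: "nat \<Rightarrow> complex \<Rightarrow> real \<Rightarrow> complex" where
  "ddmon m z x = of_nat m * dmon (m - 1) z x + \<i> * z * dmon (Suc m) z x"

lemma mon_has_vector_derivative:
  "((\<lambda>x. complex_of_real x ^ m * xi z x) has_vector_derivative dmon m z x) (at x)"
proof -
  have "((\<lambda>w. w ^ m * exp (\<i> * z * w\<^sup>2 / 2)) has_field_derivative dmon m z x) (at (of_real x))"
    by (auto intro!: derivative_eq_intros simp: dmon_def xi_def algebra_simps)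
  from has_vector_derivative_real_field[OF this] show ?thesis by (simp add: xi_def)
qed

lemma dmon_has_vector_derivative:
  "((\<lambda>x. dmon m z x) has_vector_derivative ddmon m z x) (at x)"
  unfolding dmon_def[of m] ddmon_def
  by (intro has_vector_derivative_add mon_has_vector_derivative
      bounded_linear.has_vector_derivative[OF bounded_linear_mult_right])

lemma rapid_dmon: "Im z > 0 \<Longrightarrow> rapid (dmon m z)"
  unfolding dmon_def[abs_def] by (intro rapid_add rapid_cmult rapid_power_mult rapid_xi)

lemma rapid_ddmon: "Im z > 0 \<Longrightarrow> rapid (ddmon m z)"
  unfolding ddmon_def[abs_def] by (intro rapid_add rapid_cmult rapid_dmon)

definition dgen :: "nat \<Rightarrow> (complex \<times> nat \<times> complex) list \<Rightarrow> real \<Rightarrow> complex" where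
  "dgen e rs x = lc (\<lambda>n z. dmon (2 * n + e) z x) rs"

definition ddgen :: "nat \<Rightarrow> (complex \<times> nat \<times> complex) list \<Rightarrow> real \<Rightarrow> complex" where
  "ddgen e rs x = lc (\<lambda>n z. ddmon (2 * n + e) z x) rs"

lemma gen_has_vector_derivative: "(gen e rs has_vector_derivative dgen e rs x) (at x)"
  unfolding gen_def[abs_def] dgen_def
  by (rule lc_has_vector_derivative mon_has_vector_derivative)+

lemma dgen_has_vector_derivative: "(dgen e rs has_vector_derivative ddgen e rs x) (at x)"
  unfolding dgen_def[abs_def] ddgen_def
  by (rule lc_has_vector_derivative dmon_has_vector_derivative)+

lemma rapid_dgen: "valid_rep rs \<Longrightarrow> rapid (dgen e rs)"
  unfolding dgen_def[abs_def] by (intro rapid_lc rapid_dmon valid_rep_Im)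

lemma rapid_ddgen: "valid_rep rs \<Longrightarrow> rapid (ddgen e rs)"
  unfolding ddgen_def[abs_def] by (intro rapid_lc rapid_ddmon valid_rep_Im)

text \<open>For \<open>e\<close> in \<open>{0, 1}\<close>, \<open>e * e = e\<close> gives
  \<open>(2 * n + e) * (2 * n + e - 1) / 2 = n * (2 * n - 1 + 2 * e)\<close>, the lowering
  coefficient up to sign.\<close>

lemma oscillator_gen:
  assumes "e \<le> 1"
  shows "(- ddgen e rs x + complex_of_real (x\<^sup>2) * gen e rs x) / 2 = gen e (H_rep e rs) x"
proof -
  have mon: "(- 1 / 2) * ddmon (2 * n + e) z x
      + complex_of_real (x\<^sup>2) / 2 * (complex_of_real x ^ (2 * n + e) * xi z x)
    = H_lower e n * (complex_of_real x ^ (2 * (n - 1) + e) * xi z x)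
      + H_diag e n z * (complex_of_real x ^ (2 * n + e) * xi z x)
      + (1 + z\<^sup>2) / 2 * (complex_of_real x ^ (2 * Suc n + e) * xi z x)" for n z
  proof -
    consider "e = 0" "n = 0" | "e = 1" "n = 0" | k where "n = Suc k"
      using assms by (metis le_SucE le_zero_eq One_nat_def not0_implies_Suc)
    then show ?thesis
    proof cases
      case 3
      have *: "2 * n + e - 1 - 1 = 2 * k + e" "2 * n + e = Suc (Suc (2 * k + e))"
        "2 * n + e - 1 = Suc (2 * k + e)" "n - 1 = k"
        using 3 by simp_all
      show ?thesis
        unfolding ddmon_def dmon_def * H_lower_def H_diag_def
        using assms 3
        by (cases "e = 0") (auto simp: field_simps power2_eq_square)
    qed (simp_all add: ddmon_def dmon_def H_lower_def H_diag_def field_simps power2_eq_square)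
  qed
  have "(- ddgen e rs x + complex_of_real (x\<^sup>2) * gen e rs x) / 2
    = (- 1 / 2) * ddgen e rs x + complex_of_real (x\<^sup>2) / 2 * gen e rs x"
    by (simp add: field_simps)
  also have "\<dots> = gen e (H_rep e rs) x"
    unfolding gen_def ddgen_def lc_H_rep lc_linear[symmetric] mon ..
  finally show ?thesis .
qed

lemma h_op_gen: "e \<le> 1 \<Longrightarrow> h_op (gen e rs) = gen e (H_rep e rs)"
  by (intro ext) (simp only: oscillator_gen
      h_op_eq[OF gen_has_vector_derivative dgen_has_vector_derivative])

lemma pair_gen_has_vector_derivative:
  "(pair_gen r s has_vector_derivative (dgen 0 r x + dgen 1 s x)) (at x)"
  "((\<lambda>x. dgen 0 r x + dgen 1 s x) has_vector_derivative (ddgen 0 r x + ddgen 1 s x)) (at x)"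
  unfolding pair_gen_def[abs_def]
  by (intro has_vector_derivative_add gen_has_vector_derivative dgen_has_vector_derivative)+

lemma h_op_pair_gen: "h_op (pair_gen r s) = pair_gen (H_rep 0 r) (H_rep 1 s)"
proof
  fix x
  have "h_op (pair_gen r s) x = (- ddgen 0 r x + complex_of_real (x\<^sup>2) * gen 0 r x) / 2
      + (- ddgen 1 s x + complex_of_real (x\<^sup>2) * gen 1 s x) / 2"
    unfolding h_op_eq[OF pair_gen_has_vector_derivative] pair_gen_def by (simp add: field_simps)
  then show "h_op (pair_gen r s) x = pair_gen (H_rep 0 r) (H_rep 1 s) x"
    by (simp only: oscillator_gen[OF zero_le] oscillator_gen[OF le_refl] pair_gen_def)
qed

lemma rapid_pair_gen: "valid_rep r \<Longrightarrow> valid_rep s \<Longrightarrow> rapid (pair_gen r s)"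
  unfolding pair_gen_def[abs_def] by (intro rapid_add rapid_gen)

lemma pair_gen_dom_h: "valid_rep r \<Longrightarrow> valid_rep s \<Longrightarrow> pair_gen r s \<in> dom_h"
  by (rule dom_hI[OF _ _ _ pair_gen_has_vector_derivative])
    (intro rapid_pair_gen rapid_add rapid_dgen rapid_ddgen; assumption)+

section \<open>The form in terms of lists\<close>

definition tform ::
  "nat \<Rightarrow> (complex \<times> nat \<times> complex) list \<Rightarrow> (complex \<times> nat \<times> complex) list \<Rightarrow> complex" where
  "tform e r s = (ipL2 (gen e (S_list r)) (gen e s) + ipL2 (gen e r) (gen e (S_list s))) / 2"

text \<open>Here the choices inside \<open>dec\<close>, \<open>S_hat\<close> and
  \<open>S_hat_star\<close> are eliminated once and for all.\<close>

lemma t_hat_pair_gen: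
  assumes "valid_rep r" "valid_rep s" "valid_rep r'" "valid_rep s'"
  shows "t_hat (pair_gen r s) (pair_gen r' s') = tform 0 r r' + tform 1 s s'"
  using assms
  by (simp add: t_hat_def dec_pair_gen t_hat0_def t_hat1_def S_hat_gen S_hat_star_gen tform_def
      del: One_nat_def)

lemma tform_cnj: "cnj (tform e r s) = tform e s r"
  by (simp add: tform_def ipL2_cnj)

lemma gen_S_list_append: "gen e (S_list (r @ r')) = (\<lambda>x. gen e (S_list r) x + gen e (S_list r') x)"
  and gen_S_list_scale: "gen e (S_list (scale a r)) = (\<lambda>x. a * gen e (S_list r) x)"
  by (simp_all add: gen_def fun_eq_iff lc_S_list)

lemma tform_append_right:
  assumes "valid_rep r" "valid_rep s" "valid_rep s'"
  shows "tform e r (s @ s') = tform e r s + tform e r s'"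
  unfolding tform_def gen_S_list_append gen_append
  using assms by (simp add: ipL2_add_right rapid_gen valid_rep_S_list field_simps)

lemma tform_scale_right: "tform e r (scale a s) = a * tform e r s"
  unfolding tform_def gen_S_list_scale gen_scale ipL2_cmult_right by (simp add: field_simps)

lemma tform_append_left:
  assumes "valid_rep r" "valid_rep s" "valid_rep s'"
  shows "tform e (s @ s') r = tform e s r + tform e s' r"
  by (metis assms tform_append_right tform_cnj complex_cnj_add)

lemma tform_scale_left: "tform e (scale a s) r = cnj a * tform e s r"
  by (metis tform_scale_right tform_cnj complex_cnj_mult)

lemma ipL2_H_rep:
  assumes "e \<le> 1" "valid_rep r" "valid_rep s"
  shows "ipL2 (gen e (H_rep e r)) (gen e s) = ipL2 (gen e r) (gen e (H_rep e s))"
  using h_op_symmetric[OF rapid_gen rapid_dgen rapid_ddgen gen_has_vector_derivative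
      dgen_has_vector_derivative rapid_gen rapid_dgen rapid_ddgen gen_has_vector_derivative
      dgen_has_vector_derivative, OF assms(2,2,2,3,3,3), of e e]
  by (simp only: h_op_gen[OF assms(1)])

lemma gen_commutator:
  assumes "valid_rep r"
  shows "gen e (H_rep e (S_list r)) = (\<lambda>x. gen e (S_list (H_rep e r)) x + (- \<i>) * gen e r x)"
  unfolding gen_def fun_eq_iff commutator_lc[OF assms] by simp

text \<open>The oscillator is moved across the inner product onto \<open>S s\<close> and
  \<open>S r\<close>, then commuted with \<open>S\<close>. The terms with \<open>S h\<close> cancel
  against the rest of the form, and each of the two commutators leaves \<open>- \<i> / 2\<close>
  times the inner product.\<close>

lemma tform_CCR:
  assumes e: "e \<le> 1" and r: "valid_rep r" and s: "valid_rep s"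
  shows "tform e (H_rep e r) s - cnj (tform e (H_rep e s) r) = - \<i> * ipL2 (gen e r) (gen e s)"
proof -
  note rapid = rapid_gen[OF r] rapid_gen[OF s]
    rapid_gen[OF valid_rep_S_list[OF valid_rep_H_rep[OF r]]]
    rapid_gen[OF valid_rep_S_list[OF valid_rep_H_rep[OF s]]]
  have "ipL2 (gen e (H_rep e r)) (gen e (S_list s))
      = ipL2 (gen e r) (gen e (S_list (H_rep e s))) + (- \<i>) * ipL2 (gen e r) (gen e s)"
    unfolding ipL2_H_rep[OF e r valid_rep_S_list[OF s]] gen_commutator[OF s]
    by (subst ipL2_add_right) (simp_all only: rapid rapid_cmult ipL2_cmult_right)
  moreover have "ipL2 (gen e (S_list r)) (gen e (H_rep e s))
      = ipL2 (gen e (S_list (H_rep e r))) (gen e s) + cnj (- \<i>) * ipL2 (gen e r) (gen e s)"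
    unfolding ipL2_H_rep[OF e valid_rep_S_list[OF r] s, symmetric] gen_commutator[OF r]
    by (subst ipL2_add_left) (simp_all only: rapid rapid_cmult ipL2_cmult_left)
  ultimately show ?thesis
    unfolding tform_cnj unfolding tform_def by (simp only:) (simp add: field_simps)
qed

text \<open>The cross terms vanish by parity, which matches the absence of cross terms in
  \<open>t_hat\<close>.\<close>

lemma ipL2_pair_gen:
  assumes "valid_rep r" "valid_rep s" "valid_rep r'" "valid_rep s'"
  shows "ipL2 (pair_gen r s) (pair_gen r' s')
    = ipL2 (gen 0 r) (gen 0 r') + ipL2 (gen 1 s) (gen 1 s')"
proof -
  have "ipL2 (pair_gen r s) (pair_gen r' s') =
      ipL2 (gen 0 r) (gen 0 r') + ipL2 (gen 0 r) (gen 1 s')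
      + (ipL2 (gen 1 s) (gen 0 r') + ipL2 (gen 1 s) (gen 1 s'))"
    unfolding pair_gen_def[abs_def]
    using assms by (simp add: ipL2_add_left ipL2_add_right rapid_add rapid_gen del: One_nat_def)
  moreover have "ipL2 (gen 0 r) (gen 1 s') = 0" "ipL2 (gen 1 s) (gen 0 r') = 0"
    by (rule ipL2_even_odd gen_minus)+
  ultimately show ?thesis by simp
qed

lemma pair_gen_add: "(\<lambda>x. pair_gen r s x + pair_gen r' s' x) = pair_gen (r @ r') (s @ s')"
  and pair_gen_scale: "(\<lambda>x. c * pair_gen r s x) = pair_gen (scale c r) (scale c s)"
  by (simp_all add: pair_gen_def gen_append gen_scale fun_eq_iff algebra_simps)

section \<open>Verification of the defining conditions\<close>

lemma Nfrak_E:
  assumes "f \<in> Nfrak"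
  obtains r s where "valid_rep r" "valid_rep s" "f = pair_gen r s"
  using assms by (auto simp: Nfrak_eq)

lemma pair_gen_in_Nfrak: "valid_rep r \<Longrightarrow> valid_rep s \<Longrightarrow> pair_gen r s \<in> Nfrak"
  by (auto simp: Nfrak_eq)

lemma nonzero_L2_subspace_Nfrak: "nonzero_L2_subspace Nfrak"
  unfolding nonzero_L2_subspace_def L2_subspace_def
proof (intro conjI ballI allI subsetI)
  show "f \<in> {f. L2fun f}" if "f \<in> Nfrak" for f
    using that by (elim Nfrak_E) (simp add: rapid_L2fun rapid_pair_gen)
  show "(\<lambda>x. 0) \<in> Nfrak"
    using pair_gen_in_Nfrak[of "[]" "[]"] by (simp add: pair_gen_def[abs_def] gen_def)
  show "(\<lambda>x. f x + g x) \<in> Nfrak" if "f \<in> Nfrak" "g \<in> Nfrak" for f g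
    using that by (elim Nfrak_E) (simp add: pair_gen_add pair_gen_in_Nfrak)
  show "(\<lambda>x. c * f x) \<in> Nfrak" if "f \<in> Nfrak" for c f
    using that by (elim Nfrak_E) (simp add: pair_gen_scale pair_gen_in_Nfrak valid_rep_scale)
  \<comment> \<open>The excluded point is \<open>\<i>\<close>, so \<open>2 * \<i>\<close> is taken;
    its Gaussian has no zeros.\<close>
  have "pair_gen [(1, 0, 2 * \<i>)] [] x \<noteq> 0" for x
    by (simp add: pair_gen_def gen_def xi_def)
  then have "\<not> (AE x in lborel. pair_gen [(1, 0, 2 * \<i>)] [] x = 0)"
    by (simp add: eventually_False ae_filter_eq_bot_iff)
  moreover have "pair_gen [(1, 0, 2 * \<i>)] [] \<in> Nfrak"
    by (rule pair_gen_in_Nfrak) (simp_all add: Hp_minus_i_def complex_eq_iff)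
  ultimately show "\<exists>f\<in>Nfrak. \<not> (AE x in lborel. f x = 0)" by blast
qed

lemma sesquilinear_on_t_hat: "sesquilinear_on Nfrak Nfrak t_hat"
  unfolding sesquilinear_on_def
proof (intro conjI ballI allI)
  \<comment> \<open>With the roles of the names exchanged, the last two claims are the clauses for
    the second argument.\<close>
  fix f f' g c
  assume "f \<in> Nfrak" "f' \<in> Nfrak" "g \<in> Nfrak"
  then obtain r s r' s' u v where "valid_rep r" "valid_rep s" "f = pair_gen r s"
    "valid_rep r'" "valid_rep s'" "f' = pair_gen r' s'" "valid_rep u" "valid_rep v" "g = pair_gen u v"
    by (metis Nfrak_E)
  then show "t_hat (\<lambda>x. f x + f' x) g = t_hat f g + t_hat f' g"
    "t_hat (\<lambda>x. c * f x) g = cnj c * t_hat f g"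
    "t_hat g (\<lambda>x. f x + f' x) = t_hat g f + t_hat g f'"
    "t_hat g (\<lambda>x. c * f x) = c * t_hat g f"
    by (simp_all add: pair_gen_add pair_gen_scale t_hat_pair_gen valid_rep_scale
        tform_append_left tform_append_right tform_scale_left tform_scale_right algebra_simps)
qed

theorem theorem4p9:
  shows "ultra_weak_time_operator dom_h h_op t_hat Nfrak Nfrak Nfrak Nfrak"
  unfolding ultra_weak_time_operator_def
proof (intro conjI ballI subsetI)
  fix \<phi> \<psi>
  assume "\<phi> \<in> Nfrak" "\<psi> \<in> Nfrak"
  then obtain r s u v where *: "valid_rep r" "valid_rep s" "\<phi> = pair_gen r s"
    "valid_rep u" "valid_rep v" "\<psi> = pair_gen u v"
    by (metis Nfrak_E)
  then show "cnj (t_hat \<phi> \<psi>) = t_hat \<psi> \<phi>"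
    by (simp add: t_hat_pair_gen tform_cnj)
  \<comment> \<open>Both the form and the oscillator respect parity, so the relation is the sum of
    its even and odd instances.\<close>
  have "t_hat (h_op \<phi>) \<psi> - cnj (t_hat (h_op \<psi>) \<phi>)
      = (tform 0 (H_rep 0 r) u - cnj (tform 0 (H_rep 0 u) r))
      + (tform 1 (H_rep 1 s) v - cnj (tform 1 (H_rep 1 v) s))"
    using * by (simp add: h_op_pair_gen t_hat_pair_gen valid_rep_H_rep del: One_nat_def)
  also have "\<dots> = - \<i> * ipL2 \<phi> \<psi>"
    using * by (simp add: tform_CCR ipL2_pair_gen algebra_simps del: One_nat_def)
  finally show "t_hat (h_op \<phi>) \<psi> - cnj (t_hat (h_op \<psi>) \<phi>) = - \<i> * ipL2 \<phi> \<psi>" .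
next
  fix f
  assume "f \<in> h_op ` Nfrak"
  then show "f \<in> Nfrak"
    by (auto elim!: Nfrak_E simp: h_op_pair_gen intro!: pair_gen_in_Nfrak valid_rep_H_rep)
next
  show "f \<in> dom_h \<inter> Nfrak" if "f \<in> Nfrak" for f
    using that by (auto elim: Nfrak_E intro: pair_gen_dom_h)
qed (simp_all add: nonzero_L2_subspace_Nfrak sesquilinear_on_t_hat)

end
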